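(* Let $m$ be a positive integer and let $\varepsilon$ be a primitive $m$th root of unity. The Poisson structure on $\mathbb C^{2N}$ (with coordinate functions $a_0,\dots,a_{N-1},a_0^*,\dots,a_{N-1}^*$) induced by $F_q(N)$ at $q=\varepsilon$ is given by $$\{a_i,a_j\}=-a_ia_j\ (i<j),\qquad \{a_i^*,a_j^*\}=a_i^*a_j^*\ (i<j),\qquad \{a_i,a_j^*\}=-a_ia_j^*\ (i\ne j),$$ $$\{a_i,a_i^*\}=2\sum_{k>i}a_ka_k^*.$$
   Context: $F_q(N)$ is the associative unital algebra generated by $z_0,\dots,z_{N-1},z_0^*,\dots,z_{N-1}^*$ subject to $z_iz_j=q^{-1}z_jz_i$ for $i<j$; $z_i^*z_j^*=q\,z_j^*z_i^*$ for $i<j$; $z_iz_j^*=q^{-1}z_j^*z_i$ for $i\neq j$; $z_iz_i^*-z_i^*z_i=(q^2-1)\sum_{k>i}z_kz_k^*$, where $q\in\mathbb C^*$ is the quantum parameter. At $q=\varepsilon$ the $m$th powers of all generators are central. Let $a_i$ and $a_i^*$ be the coordinate functions on $\mathbb C^{2N}$ corresponding to $z_i^m$ and $(z_i^* )^m$, $i=0,1,\dots,N-1$. The induced Poisson structure is defined on coordinate functions as follows: if $\eta,\eta'$ correspond to $x^m,y^m$, with $x,y$ generators, then $$\{\eta,\eta'\}=\lim_{q\to\varepsilon}\frac{[x^m,y^m]}{m(q^m-1)},$$ the result being expressed through the central elements $z_i^m,(z_i^* )^m$, i.e. in the $a_i,a_i^*$.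
   Formalization: False as printed for even m, N≥2: for m=2, N=2 the limit for {a_0,a_0^*} is 2z_0z_0^*z_1z_1^*, not a polynomial in the squares. Existence of the induced structure, hence the formula for {a_i,a_i^*}, is claimed only for m odd or N≤1; the other three families are proved for all m. *)

theory Defs
  imports
    Complex_Main
    "HOL-Library.Poly_Mapping"
    "HOL-Algebra.QuotRing"
begin

definition primitive_root_of_unity :: "nat \<Rightarrow> complex \<Rightarrow> bool" where
  "primitive_root_of_unity m \<epsilon> \<longleftrightarrow> m > 0 \<and> \<epsilon> ^ m = 1 \<and> (\<forall>k. 0 < k \<and> k < m \<longrightarrow> \<epsilon> ^ k \<noteq> 1)"


text \<open>\<open>Z i\<close> and \<open>Zs i\<close> name the generators $z_i$ and $z_i^*$. The same names index the
  coordinate functions $a_i$ and $a_i^*$ below.\<close>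

datatype gen = Z nat | Zs nat

definition gens :: "nat \<Rightarrow> gen set" where
  "gens N = Z ` {..<N} \<union> Zs ` {..<N}"

text \<open>Words form the free monoid, written additively so that \<^typ>\<open>(_, _) poly_mapping\<close>
  provides its monoid algebra, i.e. the free associative unital algebra, as an instance of
  \<^class>\<open>ring_1\<close>.\<close>

datatype gword = Word (letters: "gen list")

instantiation gword :: monoid_add
begin

definition zero_gword :: gword where
  "zero_gword = Word []"

definition plus_gword :: "gword \<Rightarrow> gword \<Rightarrow> gword" where
  "plus_gword u v = Word (letters u @ letters v)"

instance
  by standard (simp_all add: zero_gword_def plus_gword_def)

end

type_synonym free_algebra = "gword \<Rightarrow>\<^sub>0 complex"

definition free_alg :: "nat \<Rightarrow> free_algebra ring" where
  "free_alg N =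
     \<lparr>carrier = {p. \<forall>w \<in> Poly_Mapping.keys p. set (letters w) \<subseteq> gens N},
      mult = (*), one = 1, zero = 0, add = (+)\<rparr>"

definition free_const :: "complex \<Rightarrow> free_algebra" where
  "free_const c = Poly_Mapping.single 0 c"

definition free_gen :: "gen \<Rightarrow> free_algebra" where
  "free_gen x = Poly_Mapping.single (Word [x]) 1"

abbreviation fz :: "nat \<Rightarrow> free_algebra" where "fz i \<equiv> free_gen (Z i)"
abbreviation fzs :: "nat \<Rightarrow> free_algebra" where "fzs i \<equiv> free_gen (Zs i)"

definition F_relations :: "nat \<Rightarrow> complex \<Rightarrow> free_algebra set" where
  "F_relations N q =
     {fz i * fz j - free_const (inverse q) * (fz j * fz i) | i j. i < j \<and> j < N}
   \<union> {fzs i * fzs j - free_const q * (fzs j * fzs i) | i j. i < j \<and> j < N}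
   \<union> {fz i * fzs j - free_const (inverse q) * (fzs j * fz i) | i j. i < N \<and> j < N \<and> i \<noteq> j}
   \<union> {fz i * fzs i - fzs i * fz i
        - free_const (q^2 - 1) * (\<Sum>k\<in>{i<..<N}. fz k * fzs k) | i. i < N}"

definition F_ideal :: "nat \<Rightarrow> complex \<Rightarrow> free_algebra set" where
  "F_ideal N q = genideal (free_alg N) (F_relations N q)"

text \<open>The algebra $F_q(N)$. The generated ideal is two-sided and, as it absorbs
  multiplication by constants, also a complex subspace.\<close>

definition F_alg :: "nat \<Rightarrow> complex \<Rightarrow> free_algebra set ring" where
  "F_alg N q = free_alg N Quot F_ideal N q"

definition F_proj :: "nat \<Rightarrow> complex \<Rightarrow> free_algebra \<Rightarrow> free_algebra set" where
  "F_proj N q p = a_r_coset (free_alg N) (F_ideal N q) p"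

definition F_const :: "nat \<Rightarrow> complex \<Rightarrow> complex \<Rightarrow> free_algebra set" where
  "F_const N q c = F_proj N q (free_const c)"

definition F_gen :: "nat \<Rightarrow> complex \<Rightarrow> gen \<Rightarrow> free_algebra set" where
  "F_gen N q x = F_proj N q (free_gen x)"

definition F_commutator ::
    "nat \<Rightarrow> complex \<Rightarrow> free_algebra set \<Rightarrow> free_algebra set \<Rightarrow> free_algebra set" where
  "F_commutator N q u v =
     (u \<otimes>\<^bsub>F_alg N q\<^esub> v) \<ominus>\<^bsub>F_alg N q\<^esub> (v \<otimes>\<^bsub>F_alg N q\<^esub> u)"

text \<open>The algebras $F_q(N)$ vary with $q$, so a limit of elements $f_q \in F_q(N)$ for
  $q \to \varepsilon$ is taken through noncommutative polynomials representing the $f_q$: their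
  supports stay in one fixed finite set of words, and their coefficients converge in the
  complex numbers to those of a representative of the limit. Since ordered monomials form a
  basis of every $F_q(N)$ with structure constants in $\mathbb{Z}[q,q^{-1}]$, this is
  coefficientwise convergence in such a basis (in particular the limit is unique), without
  having to choose an ordering.\<close>

definition F_tendsto ::
    "nat \<Rightarrow> complex \<Rightarrow> (complex \<Rightarrow> free_algebra set) \<Rightarrow> free_algebra set \<Rightarrow> bool" where
  "F_tendsto N \<epsilon> f L \<longleftrightarrow>
     (\<exists>r l S. finite S \<and> l \<in> carrier (free_alg N) \<and> F_proj N \<epsilon> l = L
        \<and> (\<forall>\<^sub>F q in at \<epsilon>. r q \<in> carrier (free_alg N) \<and> Poly_Mapping.keys (r q) \<subseteq> S
              \<and> F_proj N q (r q) = f q)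
        \<and> (\<forall>w. ((\<lambda>q. Poly_Mapping.lookup (r q) w) \<longlongrightarrow> Poly_Mapping.lookup l w) (at \<epsilon>)))"


text \<open>The algebra of polynomial functions on $\mathbb{C}^{2N}$, as polynomials in the $2N$
  coordinate functions indexed by \<^term>\<open>gens N\<close>.\<close>

type_synonym coord_poly = "(gen \<Rightarrow>\<^sub>0 nat) \<Rightarrow>\<^sub>0 complex"

definition coord_ring :: "nat \<Rightarrow> coord_poly ring" where
  "coord_ring N =
     \<lparr>carrier = {p. \<forall>t \<in> Poly_Mapping.keys p. Poly_Mapping.keys t \<subseteq> gens N},
      mult = (*), one = 1, zero = 0, add = (+)\<rparr>"

definition coord_const :: "complex \<Rightarrow> coord_poly" where
  "coord_const c = Poly_Mapping.single 0 c"

definition coord :: "gen \<Rightarrow> coord_poly" where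
  "coord x = Poly_Mapping.single (Poly_Mapping.single x 1) 1"

abbreviation coord_a :: "nat \<Rightarrow> coord_poly" where "coord_a i \<equiv> coord (Z i)"
abbreviation coord_as :: "nat \<Rightarrow> coord_poly" where "coord_as i \<equiv> coord (Zs i)"

definition poisson_structure :: "nat \<Rightarrow> (coord_poly \<Rightarrow> coord_poly \<Rightarrow> coord_poly) \<Rightarrow> bool" where
  "poisson_structure N br \<longleftrightarrow>
     (let A = carrier (coord_ring N) in
        (\<forall>f\<in>A. \<forall>g\<in>A. br f g \<in> A)
      \<and> (\<forall>f\<in>A. \<forall>g\<in>A. \<forall>h\<in>A. br (f + g) h = br f h + br g h)
      \<and> (\<forall>c. \<forall>f\<in>A. \<forall>g\<in>A. br (coord_const c * f) g = coord_const c * br f g)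
      \<and> (\<forall>f\<in>A. \<forall>g\<in>A. br f g = - br g f)
      \<and> (\<forall>f\<in>A. \<forall>g\<in>A. \<forall>h\<in>A. br (f * g) h = f * br g h + br f h * g)
      \<and> (\<forall>f\<in>A. \<forall>g\<in>A. \<forall>h\<in>A. br f (br g h) + br g (br h f) + br h (br f g) = 0))"

text \<open>The correspondence sending $a_i$, $a_i^*$ to the central elements $z_i^m$, $(z_i^*)^m$ of
  $F_\varepsilon(N)$, as a homomorphism of complex algebras.\<close>

definition coord_correspondence ::
    "nat \<Rightarrow> nat \<Rightarrow> complex \<Rightarrow> (coord_poly \<Rightarrow> free_algebra set) \<Rightarrow> bool" where
  "coord_correspondence N m \<epsilon> \<phi> \<longleftrightarrow>
     \<phi> \<in> ring_hom (coord_ring N) (F_alg N \<epsilon>)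
     \<and> (\<forall>c. \<phi> (coord_const c) = F_const N \<epsilon> c)
     \<and> (\<forall>x\<in>gens N. \<phi> (coord x) = F_gen N \<epsilon> x [^]\<^bsub>F_alg N \<epsilon>\<^esub> m)"

text \<open>\<open>induced_bracket N m \<epsilon> x y P\<close>: the limit
  $\lim_{q\to\varepsilon} [x^m,y^m] / (m(q^m-1))$ exists and, expressed through the central
  elements $z_i^m$, $(z_i^*)^m$, is the polynomial \<open>P\<close> in the coordinate functions.\<close>

definition induced_bracket ::
    "nat \<Rightarrow> nat \<Rightarrow> complex \<Rightarrow> gen \<Rightarrow> gen \<Rightarrow> coord_poly \<Rightarrow> bool" where
  "induced_bracket N m \<epsilon> x y P \<longleftrightarrow>
     P \<in> carrier (coord_ring N) \<and>
     (\<exists>\<phi>. coord_correspondence N m \<epsilon> \<phi> \<and>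
        F_tendsto N \<epsilon>
          (\<lambda>q. F_const N q (1 / (of_nat m * (q ^ m - 1))) \<otimes>\<^bsub>F_alg N q\<^esub>
                 F_commutator N q (F_gen N q x [^]\<^bsub>F_alg N q\<^esub> m) (F_gen N q y [^]\<^bsub>F_alg N q\<^esub> m))
          (\<phi> P))"

text \<open>The defining limits need not all be expressible through the elements $z_i^m$, $(z_i^*)^m$:
  for even $m = 2n$ and $i = N - 2$, the limit of $[z_i^m,(z_i^*)^m]/(m(q^m-1))$ is
  $2 z_i^n (z_i^*)^n z_{i+1}^n (z_{i+1}^*)^n$. Hence for even $m$ and $N \ge 2$ no bracket
  satisfies the following predicate.\<close>

definition induced_poisson_structure ::
    "nat \<Rightarrow> nat \<Rightarrow> complex \<Rightarrow> (coord_poly \<Rightarrow> coord_poly \<Rightarrow> coord_poly) \<Rightarrow> bool" where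
  "induced_poisson_structure N m \<epsilon> br \<longleftrightarrow>
     poisson_structure N br \<and>
     (\<forall>x\<in>gens N. \<forall>y\<in>gens N. induced_bracket N m \<epsilon> x y (br (coord x) (coord y)))"

end

theory Submission
  imports
    Defs
    "HOL-Computational_Algebra.Polynomial"
    "HOL-Computational_Algebra.Fundamental_Theorem_Algebra"
begin

text \<open>Put $A = \sum_{k>i} z_kz_k^*$ and $C = z_iz_i^* + A$. Then $C$ commutes with $z_i$, $z_i^*$
  and $A$, while $z_iA = q^{-2}Az_i$ and $z_i^*A = q^2Az_i^*$, so that
  $$z_i^m(z_i^*)^m = \prod_{k<m}(C-q^{-2k}A), \qquad (z_i^*)^mz_i^m = \prod_{k=1}^m(C-q^{2k}A).$$
  The two products agree at $q = \varepsilon$, and the difference divided by $m(q^m-1)$ tends to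
  $-\frac{2}{m}A\,\partial_A\prod_k(C-\varepsilon^{2k}A)$, which for odd $m$ is
  $2A^m = 2\sum_{k>i}z_k^m(z_k^*)^m$. The remaining pairs of generators commute up to a power of
  $q$.

  Limits are unique, and the correspondence with central elements is injective, because the
  algebras $F_q(N)$ act on functions of $(t,y)$ by operators depending continuously on $q$: $z_i$
  multiplies by $t_i$ and dilates the $t_j$, $y_j$ with $j>i$, and $\sum_{k\ge i}z_kz_k^*$
  multiplies by $y_i$. At $q = \varepsilon$ the elements $z_i^m$, $(z_i^*)^m$ act by scalars, and
  these scalars take every value in $(\mathbb{C}^*)^{2N}$.\<close>

section \<open>The free algebra modulo the defining relations\<close>

text \<open>The operator -2/m A d/dA comes from a rescaling. Since q^(-2(m-k)) = q^(-2m) q^(2k), the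
  first product is the second one with A replaced by q^(-2m) A, so the commutator is a finite
  difference of one polynomial; as q^(-2m) - 1 = -(q^m - 1)(q^m + 1) / q^(2m), division by m(q^m -
  1) leaves -2/m in the limit. Oddness of m matters because only then \<epsilon>^2 is again a
  primitive m-th root of unity and the product collapses to C^m - A^m. For even m the limits still
  exist, but for N >= 2 one of them is no polynomial in the m-th powers. Hence the separate parts of
  the statement: formulas for every induced structure, existence for odd m or N <= 1, and the limits
  that are expressible for all m. Uniqueness of limits is not derived from a basis of ordered
  monomials; a family of representations that separates polynomials in the m-th powers suffices and
  needs no diamond lemma. The Jacobi identity is checked directly for the biderivation given by the
  formulas.\<close>

lemma carrier_free_alg:
  "p \<in> carrier (free_alg N) \<longleftrightarrow> (\<forall>w \<in> Poly_Mapping.keys p. set (letters w) \<subseteq> gens N)"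
  by (simp add: free_alg_def)

lemma free_alg_simps [simp]:
  "x \<otimes>\<^bsub>free_alg N\<^esub> y = x * y" "\<one>\<^bsub>free_alg N\<^esub> = 1"
  "\<zero>\<^bsub>free_alg N\<^esub> = 0" "x \<oplus>\<^bsub>free_alg N\<^esub> y = x + y"
  by (simp_all add: free_alg_def)

lemma free_carrier_add [simp, intro]:
  "x \<in> carrier (free_alg N) \<Longrightarrow> y \<in> carrier (free_alg N) \<Longrightarrow> x + y \<in> carrier (free_alg N)"
  using keys_add[of x y] by (force simp: carrier_free_alg)

lemma free_carrier_mult [simp, intro]:
  assumes "x \<in> carrier (free_alg N)" "y \<in> carrier (free_alg N)"
  shows "x * y \<in> carrier (free_alg N)"
  unfolding carrier_free_alg
proof
  fix w assume "w \<in> Poly_Mapping.keys (x * y)"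
  then obtain a b where "w = a + b" "a \<in> Poly_Mapping.keys x" "b \<in> Poly_Mapping.keys y"
    using keys_mult[of x y] by blast
  then show "set (letters w) \<subseteq> gens N"
    using assms by (force simp: carrier_free_alg plus_gword_def)
qed

lemma free_carrier_const [simp, intro]: "free_const c \<in> carrier (free_alg N)"
  by (auto simp: carrier_free_alg free_const_def zero_gword_def)

lemma free_const_hom:
  "free_const 0 = 0" "free_const 1 = 1"
  "free_const (a + b) = free_const a + free_const b"
  "free_const (a - b) = free_const a - free_const b"
  "free_const (- a) = - free_const a"
  "free_const (a * b) = free_const a * free_const b"
  by (simp_all add: free_const_def single_add single_diff single_uminus mult_single)

lemma free_carrier_0 [simp, intro]: "0 \<in> carrier (free_alg N)"
  and free_carrier_1 [simp, intro]: "1 \<in> carrier (free_alg N)"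
  using free_carrier_const[of 0 N] free_carrier_const[of 1 N] by (simp_all add: free_const_hom)

lemma free_carrier_uminus [simp, intro]:
  "x \<in> carrier (free_alg N) \<Longrightarrow> - x \<in> carrier (free_alg N)"
  by (simp add: carrier_free_alg)

lemma free_carrier_diff [simp, intro]:
  "x \<in> carrier (free_alg N) \<Longrightarrow> y \<in> carrier (free_alg N) \<Longrightarrow> x - y \<in> carrier (free_alg N)"
  by (simp only: diff_conv_add_uminus free_carrier_add free_carrier_uminus)

lemma free_carrier_gen [simp, intro]: "x \<in> gens N \<Longrightarrow> free_gen x \<in> carrier (free_alg N)"
  by (simp add: carrier_free_alg free_gen_def)

lemma gens_simps [simp]: "Z i \<in> gens N \<longleftrightarrow> i < N" "Zs i \<in> gens N \<longleftrightarrow> i < N"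
  by (auto simp: gens_def)

lemma finite_gens [simp]: "finite (gens N)"
  by (simp add: gens_def)

lemma free_carrier_power [simp, intro]:
  "x \<in> carrier (free_alg N) \<Longrightarrow> x ^ n \<in> carrier (free_alg N)"
  by (induction n) simp_all

lemma free_carrier_sum [simp, intro]:
  "(\<And>k. k \<in> K \<Longrightarrow> f k \<in> carrier (free_alg N)) \<Longrightarrow> sum f K \<in> carrier (free_alg N)"
  by (induction K rule: infinite_finite_induct) simp_all

lemma free_carrier_prod_list [simp, intro]:
  "(\<And>x. x \<in> set xs \<Longrightarrow> f x \<in> carrier (free_alg N)) \<Longrightarrow> prod_list (map f xs) \<in> carrier (free_alg N)"
  by (induction xs) simp_all

lemma lookup_const_mult [simp]:
  "Poly_Mapping.lookup (free_const c * p) w = c * Poly_Mapping.lookup p w"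
  by (simp add: free_const_def flip: mult_map_scale_conv_mult)
     (simp add: map.rep_eq when_def in_keys_iff)

text \<open>Reduces identities that are additive in each argument to single monomials.\<close>

lemma poly_mapping_single_induct [case_names single add]:
  fixes p :: "'a \<Rightarrow>\<^sub>0 'b::comm_monoid_add"
  assumes single: "\<And>k c. P (Poly_Mapping.single k c)" and add: "\<And>a b. P a \<Longrightarrow> P b \<Longrightarrow> P (a + b)"
  shows "P p"
proof (induction p rule: update_induct)
  case const
  \<comment> \<open>A monomial with coefficient 0 is zero, whatever its key.\<close>
  show ?case using single[of undefined 0] by simp
next
  case (update f k v)
  have "Poly_Mapping.update k v f = f + Poly_Mapping.single k v"
    using update by (intro poly_mapping_eqI)
      (auto simp: lookup_update lookup_add lookup_single when_def in_keys_iff)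
  then show ?case using update single add by simp
qed

lemma free_const_commute: "p * free_const c = free_const c * p"
  by (induction p rule: poly_mapping_single_induct)
     (simp_all add: free_const_def mult_single mult.commute distrib_left distrib_right)

lemma free_const_left_commute: "p * (free_const c * r) = free_const c * (p * r)"
  by (metis free_const_commute mult.assoc)

lemma ring_free_alg: "ring (free_alg N)"
proof (rule ringI)
  show "abelian_group (free_alg N)"
    by (rule abelian_groupI) (auto simp: add.assoc add.commute intro!: bexI[of _ "- x" for x])
  show "Group.monoid (free_alg N)"
    by (rule monoidI) (auto simp: mult.assoc)
qed (auto simp: distrib_left distrib_right)

lemma free_alg_a_inv:
  "x \<in> carrier (free_alg N) \<Longrightarrow> \<ominus>\<^bsub>free_alg N\<^esub> x = - x"
  by (rule abelian_group.minus_equality[OF ring.is_abelian_group[OF ring_free_alg]]) simp_all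

lemma F_relations_carrier: "F_relations N q \<subseteq> carrier (free_alg N)"
  by (force simp: F_relations_def)

lemma ideal_F_ideal: "ideal (F_ideal N q) (free_alg N)"
  unfolding F_ideal_def by (rule ring.genideal_ideal[OF ring_free_alg F_relations_carrier])

lemma F_relations_ideal: "F_relations N q \<subseteq> F_ideal N q"
  unfolding F_ideal_def by (rule ring.genideal_self[OF ring_free_alg F_relations_carrier])

lemma F_ideal_closed:
  "0 \<in> F_ideal N q"
  "x \<in> F_ideal N q \<Longrightarrow> y \<in> F_ideal N q \<Longrightarrow> x + y \<in> F_ideal N q"
  "x \<in> F_ideal N q \<Longrightarrow> - x \<in> F_ideal N q"
  "x \<in> F_ideal N q \<Longrightarrow> a \<in> carrier (free_alg N) \<Longrightarrow> a * x \<in> F_ideal N q"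
  "x \<in> F_ideal N q \<Longrightarrow> a \<in> carrier (free_alg N) \<Longrightarrow> x * a \<in> F_ideal N q"
proof -
  interpret ideal "F_ideal N q" "free_alg N" by (rule ideal_F_ideal)
  show "0 \<in> F_ideal N q"
    using additive_subgroup.zero_closed[OF is_additive_subgroup] by simp
  show "x \<in> F_ideal N q \<Longrightarrow> y \<in> F_ideal N q \<Longrightarrow> x + y \<in> F_ideal N q"
    using additive_subgroup.a_closed[OF is_additive_subgroup] by simp
  show "x \<in> F_ideal N q \<Longrightarrow> - x \<in> F_ideal N q"
    using additive_subgroup.a_inv_closed[OF is_additive_subgroup] Icarr
    by (simp add: free_alg_a_inv)
  show "x \<in> F_ideal N q \<Longrightarrow> a \<in> carrier (free_alg N) \<Longrightarrow> a * x \<in> F_ideal N q"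
    using I_l_closed by simp
  show "x \<in> F_ideal N q \<Longrightarrow> a \<in> carrier (free_alg N) \<Longrightarrow> x * a \<in> F_ideal N q"
    using I_r_closed by simp
qed

text \<open>Equality of cosets expressed on representatives: calculations then stay in the type
  class ring of the free algebra, and cosets appear only at the interface
  \<open>F_proj_eq_iff\<close>.\<close>

definition fcong :: "nat \<Rightarrow> complex \<Rightarrow> free_algebra \<Rightarrow> free_algebra \<Rightarrow> bool" where
  "fcong N q a b \<longleftrightarrow>
     a \<in> carrier (free_alg N) \<and> b \<in> carrier (free_alg N) \<and> a - b \<in> F_ideal N q"

lemma fcong_refl [simp]: "fcong N q a a \<longleftrightarrow> a \<in> carrier (free_alg N)"
  by (simp add: fcong_def F_ideal_closed)

lemma fcong_sym: "fcong N q a b \<Longrightarrow> fcong N q b a"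
  using F_ideal_closed(3)[of "a - b" N q] by (simp add: fcong_def)

lemma fcong_trans [trans]: "fcong N q a b \<Longrightarrow> fcong N q b c \<Longrightarrow> fcong N q a c"
  using F_ideal_closed(2)[of "a - b" N q "b - c"] by (simp add: fcong_def)

lemma fcong_carrier:
  "fcong N q a b \<Longrightarrow> a \<in> carrier (free_alg N)" "fcong N q a b \<Longrightarrow> b \<in> carrier (free_alg N)"
  by (simp_all add: fcong_def)

lemma fcong_add: "fcong N q a b \<Longrightarrow> fcong N q c d \<Longrightarrow> fcong N q (a + c) (b + d)"
  using F_ideal_closed(2)[of "a - b" N q "c - d"] by (simp add: fcong_def algebra_simps)

lemma fcong_uminus: "fcong N q a b \<Longrightarrow> fcong N q (- a) (- b)"
  using F_ideal_closed(3)[of "a - b" N q] by (simp add: fcong_def)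

lemma fcong_diff: "fcong N q a b \<Longrightarrow> fcong N q c d \<Longrightarrow> fcong N q (a - c) (b - d)"
  using fcong_add[OF _ fcong_uminus] by fastforce

lemma fcong_mult:
  assumes "fcong N q a b" "fcong N q c d"
  shows "fcong N q (a * c) (b * d)"
proof -
  have "a * c - b * d = (a - b) * c + b * (c - d)"
    by (simp add: algebra_simps)
  with assms show ?thesis by (simp add: fcong_def F_ideal_closed)
qed

lemma fcong_sum:
  "(\<And>k. k \<in> K \<Longrightarrow> fcong N q (f k) (g k)) \<Longrightarrow> fcong N q (sum f K) (sum g K)"
  by (induction K rule: infinite_finite_induct) (simp_all add: fcong_add)

lemma F_proj_eq_iff:
  assumes "a \<in> carrier (free_alg N)" "b \<in> carrier (free_alg N)"
  shows "F_proj N q a = F_proj N q b \<longleftrightarrow> fcong N q a b"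
proof -
  interpret ideal "F_ideal N q" "free_alg N" by (rule ideal_F_ideal)
  show ?thesis
    using quotient_eq_iff_same_a_r_cos[OF ideal_axioms assms] assms
    by (simp add: F_proj_def fcong_def a_minus_def free_alg_a_inv)
qed

lemma F_proj_hom: "F_proj N q \<in> ring_hom (free_alg N) (F_alg N q)"
  unfolding F_proj_def[abs_def] F_alg_def by (rule ideal.rcos_ring_hom[OF ideal_F_ideal])

lemma ring_F_alg: "ring (F_alg N q)"
  unfolding F_alg_def by (rule ideal.quotient_is_ring[OF ideal_F_ideal])

lemma F_alg_carrier: "u \<in> carrier (F_alg N q) \<longleftrightarrow> (\<exists>a \<in> carrier (free_alg N). u = F_proj N q a)"
  by (auto simp: F_alg_def FactRing_def F_proj_def A_RCOSETS_def' A_RCOSETS_defs a_r_coset_def)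

lemma F_proj_carrier [simp]: "a \<in> carrier (free_alg N) \<Longrightarrow> F_proj N q a \<in> carrier (F_alg N q)"
  using F_alg_carrier by blast

lemma F_proj_mult:
  "a \<in> carrier (free_alg N) \<Longrightarrow> b \<in> carrier (free_alg N) \<Longrightarrow>
     F_proj N q a \<otimes>\<^bsub>F_alg N q\<^esub> F_proj N q b = F_proj N q (a * b)"
  using ring_hom_mult[OF F_proj_hom] by simp

lemma F_proj_add:
  "a \<in> carrier (free_alg N) \<Longrightarrow> b \<in> carrier (free_alg N) \<Longrightarrow>
     F_proj N q a \<oplus>\<^bsub>F_alg N q\<^esub> F_proj N q b = F_proj N q (a + b)"
  using ring_hom_add[OF F_proj_hom] by simp

lemma F_proj_one: "\<one>\<^bsub>F_alg N q\<^esub> = F_proj N q 1"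
  using ring_hom_one[OF F_proj_hom] by simp

lemma F_proj_zero: "\<zero>\<^bsub>F_alg N q\<^esub> = F_proj N q 0"
  using ring_hom_zero[OF F_proj_hom ring_free_alg ring_F_alg] by simp

lemma F_proj_minus:
  assumes "a \<in> carrier (free_alg N)" "b \<in> carrier (free_alg N)"
  shows "F_proj N q a \<ominus>\<^bsub>F_alg N q\<^esub> F_proj N q b = F_proj N q (a - b)"
proof -
  interpret ring "F_alg N q" by (rule ring_F_alg)
  have "\<ominus>\<^bsub>F_alg N q\<^esub> F_proj N q b = F_proj N q (- b)"
    using assms by (intro minus_equality) (simp_all add: F_proj_add F_proj_zero)
  then show ?thesis
    using assms by (simp add: a_minus_def F_proj_add)
qed

lemma F_proj_pow:
  "a \<in> carrier (free_alg N) \<Longrightarrow> F_proj N q a [^]\<^bsub>F_alg N q\<^esub> (n::nat) = F_proj N q (a ^ n)"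
  by (induction n) (simp_all add: nat_pow_def F_proj_one F_proj_mult power_Suc2 del: power_Suc)

section \<open>Computations in the quotient algebra\<close>

text \<open>The constant is multiplicative in both arguments, so commutation rules for products and
  powers are obtained by multiplying the constants of the generators.\<close>

definition qcom :: "nat \<Rightarrow> complex \<Rightarrow> complex \<Rightarrow> free_algebra \<Rightarrow> free_algebra \<Rightarrow> bool" where
  "qcom N q c x y \<longleftrightarrow> x \<in> carrier (free_alg N) \<and> y \<in> carrier (free_alg N)
     \<and> fcong N q (x * y) (free_const c * (y * x))"

lemma fcong_mult_left:
  "a \<in> carrier (free_alg N) \<Longrightarrow> fcong N q c d \<Longrightarrow> fcong N q (a * c) (a * d)"
  and fcong_mult_right:
  "a \<in> carrier (free_alg N) \<Longrightarrow> fcong N q c d \<Longrightarrow> fcong N q (c * a) (d * a)"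
  by (simp_all add: fcong_mult)

lemma fcong_const_cancel:
  "fcong N q a b \<Longrightarrow> fcong N q (free_const c * a) (free_const c * b)"
  by (simp add: fcong_mult_left)

lemma free_const_mult_assoc: "free_const c * (free_const d * p) = free_const (c * d) * p"
  by (simp add: free_const_hom mult.assoc)

lemma qcom_refl: "x \<in> carrier (free_alg N) \<Longrightarrow> qcom N q 1 x x"
  by (simp add: qcom_def free_const_hom)

lemma qcom_one_right: "x \<in> carrier (free_alg N) \<Longrightarrow> qcom N q 1 x 1"
  and qcom_one_left: "x \<in> carrier (free_alg N) \<Longrightarrow> qcom N q 1 1 x"
  by (simp_all add: qcom_def free_const_hom)

lemma qcom_mult_right:
  assumes "qcom N q c x a" "qcom N q d x b"
  shows "qcom N q (c * d) x (a * b)"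
proof -
  note carr = assms[unfolded qcom_def]
  have "fcong N q ((x * a) * b) ((free_const c * (a * x)) * b)"
    using carr by (intro fcong_mult_right) simp_all
  also have "(free_const c * (a * x)) * b = free_const c * (a * (x * b))"
    by (simp add: mult.assoc)
  also have "fcong N q \<dots> (free_const c * (a * (free_const d * (b * x))))"
    using carr by (intro fcong_mult_left) simp_all
  also have "\<dots> = free_const (c * d) * ((a * b) * x)"
    by (simp add: free_const_left_commute[of a] free_const_mult_assoc mult.assoc)
  finally show ?thesis using carr by (simp add: qcom_def mult.assoc)
qed

lemma qcom_mult_left:
  assumes "qcom N q c a y" "qcom N q d b y"
  shows "qcom N q (c * d) (a * b) y"
proof -
  note carr = assms[unfolded qcom_def]
  have "fcong N q (a * (b * y)) (a * (free_const d * (y * b)))"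
    using carr by (intro fcong_mult_left) simp_all
  also have "a * (free_const d * (y * b)) = free_const d * ((a * y) * b)"
    by (simp add: free_const_left_commute[of a] mult.assoc)
  also have "fcong N q \<dots> (free_const d * ((free_const c * (y * a)) * b))"
    using carr by (intro fcong_const_cancel fcong_mult_right) simp_all
  also have "\<dots> = free_const (c * d) * (y * (a * b))"
    by (simp add: free_const_mult_assoc mult.assoc mult.commute[of c d])
  finally show ?thesis using carr by (simp add: qcom_def mult.assoc)
qed

lemma qcom_sym:
  assumes "qcom N q c x y" "c \<noteq> 0"
  shows "qcom N q (inverse c) y x"
proof -
  have "fcong N q (free_const (inverse c) * (free_const c * (y * x))) (free_const (inverse c) * (x * y))"
    using assms by (intro fcong_const_cancel) (simp add: qcom_def fcong_sym)
  then show ?thesis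
    using assms by (simp add: qcom_def free_const_mult_assoc free_const_hom(2))
qed

lemma qcom_carrier:
  "qcom N q c x y \<Longrightarrow> x \<in> carrier (free_alg N)" "qcom N q c x y \<Longrightarrow> y \<in> carrier (free_alg N)"
  by (simp_all add: qcom_def)

lemma qcom_power_right: "qcom N q c x y \<Longrightarrow> qcom N q (c ^ n) x (y ^ n)"
  by (induction n) (auto intro: qcom_mult_right qcom_one_right qcom_carrier)

lemma qcom_power_left: "qcom N q c x y \<Longrightarrow> qcom N q (c ^ n) (x ^ n) y"
  by (induction n) (auto intro: qcom_mult_left qcom_one_left qcom_carrier)

text \<open>For k = n = m and c = q the constant is q^(m^2), which is 1 at \<epsilon> and whose
  deviation from 1 near \<epsilon> produces the quadratic brackets.\<close>

lemma qcom_power: "qcom N q c x y \<Longrightarrow> qcom N q (c ^ (k * n)) (x ^ k) (y ^ n)"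
  unfolding power_mult by (intro qcom_power_left qcom_power_right)

lemma qcom_add_right:
  assumes "qcom N q c x a" "qcom N q c x b"
  shows "qcom N q c x (a + b)"
  using assms fcong_add[of N q "x * a" "free_const c * (a * x)" "x * b" "free_const c * (b * x)"]
  by (simp add: qcom_def distrib_left distrib_right)

lemma qcom_sum_right:
  assumes "x \<in> carrier (free_alg N)" "\<And>k. k \<in> K \<Longrightarrow> qcom N q c x (f k)"
  shows "qcom N q c x (sum f K)"
  using assms(2)
proof (induction K rule: infinite_finite_induct)
  case (insert k K)
  then show ?case by (simp add: qcom_add_right)
qed (simp_all add: qcom_def assms(1))

lemma qcom_commute_iff:
  "qcom N q 1 x y \<longleftrightarrow> x \<in> carrier (free_alg N) \<and> y \<in> carrier (free_alg N)
     \<and> fcong N q (x * y) (y * x)"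
  by (simp add: qcom_def free_const_hom)

lemma qcom_relationI:
  assumes "x \<in> carrier (free_alg N)" "y \<in> carrier (free_alg N)"
    and "x * y - free_const c * (y * x) \<in> F_relations N q"
  shows "qcom N q c x y"
  using assms F_relations_ideal[of N q] by (auto simp: qcom_def fcong_def)

lemma qcom_z_z: "i < j \<Longrightarrow> j < N \<Longrightarrow> qcom N q (inverse q) (fz i) (fz j)"
  by (rule qcom_relationI) (auto simp: F_relations_def)

lemma qcom_zs_zs: "i < j \<Longrightarrow> j < N \<Longrightarrow> qcom N q q (fzs i) (fzs j)"
  by (rule qcom_relationI) (auto simp: F_relations_def)

lemma qcom_z_zs: "i < N \<Longrightarrow> j < N \<Longrightarrow> i \<noteq> j \<Longrightarrow> qcom N q (inverse q) (fz i) (fzs j)"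
  by (rule qcom_relationI) (auto simp: F_relations_def)

lemma qcom_zs_z: "q \<noteq> 0 \<Longrightarrow> i < N \<Longrightarrow> j < N \<Longrightarrow> i \<noteq> j \<Longrightarrow> qcom N q q (fzs i) (fz j)"
  using qcom_sym[OF qcom_z_zs, of j N i q] by simp

section \<open>Tail sums and their commutation rules\<close>

definition tail_sum :: "nat \<Rightarrow> nat \<Rightarrow> free_algebra" where
  "tail_sum N i = (\<Sum>k\<in>{i<..<N}. fz k * fzs k)"

lemma tail_sum_carrier [simp]: "tail_sum N i \<in> carrier (free_alg N)"
  by (auto simp: tail_sum_def)

lemma fcong_z_zs:
  "i < N \<Longrightarrow> fcong N q (fz i * fzs i) (fzs i * fz i + free_const (q^2 - 1) * tail_sum N i)"
  using F_relations_ideal[of N q] tail_sum_carrier[of N i]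
  by (auto simp: fcong_def F_relations_def tail_sum_def diff_diff_eq)

text \<open>Every summand z_k zs_k with k > i contributes q^(-1) from z_k and q^(-1) from zs_k, so
  all summands share one constant.\<close>

lemma qcom_z_tail: "i < N \<Longrightarrow> qcom N q (inverse (q^2)) (fz i) (tail_sum N i)"
  unfolding tail_sum_def power2_eq_square inverse_mult_distrib
  by (intro qcom_sum_right qcom_mult_right qcom_z_z qcom_z_zs) auto

lemma qcom_zs_tail: "q \<noteq> 0 \<Longrightarrow> i < N \<Longrightarrow> qcom N q (q^2) (fzs i) (tail_sum N i)"
  unfolding tail_sum_def power2_eq_square
  by (intro qcom_sum_right qcom_mult_right qcom_zs_zs qcom_zs_z) auto

text \<open>\<open>tail_sum N i\<close> and \<open>head_sum N i\<close> are the elements $A$ and $C$ of the introduction.\<close>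

definition head_sum :: "nat \<Rightarrow> nat \<Rightarrow> free_algebra" where
  "head_sum N i = fz i * fzs i + tail_sum N i"

lemma head_sum_carrier [simp]: "i < N \<Longrightarrow> head_sum N i \<in> carrier (free_alg N)"
  by (auto simp: head_sum_def)

text \<open>Moving A past z_i and past zs_i gives the inverse constants q^(-2) and q^2, so A
  commutes with z_i zs_i and hence with C.\<close>

lemma qcom_head_tail:
  assumes "q \<noteq> 0" "i < N"
  shows "qcom N q 1 (head_sum N i) (tail_sum N i)"
proof -
  have "qcom N q 1 (fz i * fzs i) (tail_sum N i)"
    using qcom_mult_left[OF qcom_z_tail qcom_zs_tail, of i N q] assms by simp
  then have "fcong N q (fz i * fzs i * tail_sum N i) (tail_sum N i * (fz i * fzs i))"
    by (simp add: qcom_commute_iff)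
  then have "fcong N q (fz i * fzs i * tail_sum N i + tail_sum N i * tail_sum N i)
      (tail_sum N i * (fz i * fzs i) + tail_sum N i * tail_sum N i)"
    by (intro fcong_add) auto
  then show ?thesis
    using assms by (simp add: qcom_commute_iff head_sum_def distrib_left distrib_right)
qed

text \<open>The last defining relation in terms of C and A. Together with z_i zs_i = C - A it makes
  both products of z_i and zs_i linear forms in C and A.\<close>

lemma fcong_zs_z:
  assumes "i < N"
  shows "fcong N q (fzs i * fz i) (head_sum N i - free_const (q^2) * tail_sum N i)"
proof -
  have "fcong N q (fz i * fzs i - free_const (q^2 - 1) * tail_sum N i)
      (fzs i * fz i + free_const (q^2 - 1) * tail_sum N i - free_const (q^2 - 1) * tail_sum N i)"
    using assms by (intro fcong_diff fcong_z_zs) auto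
  then show ?thesis
    by (intro fcong_sym[of N q "head_sum N i - free_const (q\<^sup>2) * tail_sum N i"])
       (simp add: head_sum_def free_const_hom algebra_simps)
qed

text \<open>C z_i = z_i (zs_i z_i) + A z_i = z_i (C - q^2 A) + q^2 z_i A, and the two terms with A
  cancel.\<close>

lemma qcom_z_head:
  assumes "q \<noteq> 0" "i < N"
  shows "qcom N q 1 (fz i) (head_sum N i)"
proof -
  let ?A = "tail_sum N i" and ?C = "head_sum N i"
  have "fcong N q (?C * fz i) (fz i * (?C - free_const (q^2) * ?A) + ?A * fz i)"
  proof -
    have "?C * fz i = fz i * (fzs i * fz i) + ?A * fz i"
      by (simp add: head_sum_def distrib_right mult.assoc)
    then show ?thesis
      using assms fcong_zs_z[OF assms(2), of q]
      by (simp only:) (intro fcong_add fcong_mult_left, auto)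
  qed
  also have "fcong N q \<dots> (fz i * (?C - free_const (q^2) * ?A) + free_const (q^2) * (fz i * ?A))"
  proof -
    have "qcom N q (q^2) ?A (fz i)"
      using qcom_sym[OF qcom_z_tail, of i N q] assms by simp
    then show ?thesis using assms by (intro fcong_add) (auto simp: qcom_def)
  qed
  also have "\<dots> = fz i * ?C"
    by (simp add: right_diff_distrib free_const_left_commute[of "fz i"])
  finally show ?thesis using assms by (simp add: qcom_commute_iff fcong_sym)
qed

lemma qcom_zs_head:
  assumes "q \<noteq> 0" "i < N"
  shows "qcom N q 1 (fzs i) (head_sum N i)"
proof -
  let ?A = "tail_sum N i" and ?C = "head_sum N i"
  have "fzs i * ?C = (fzs i * fz i) * fzs i + fzs i * ?A"
    by (simp add: head_sum_def algebra_simps)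
  also have "fcong N q \<dots> ((?C - free_const (q^2) * ?A) * fzs i + free_const (q^2) * (?A * fzs i))"
    using assms fcong_zs_z[OF assms(2), of q] qcom_zs_tail[OF assms]
    by (intro fcong_add fcong_mult_right) (auto simp: qcom_def)
  also have "\<dots> = ?C * fzs i"
    by (simp add: left_diff_distrib mult.assoc)
  finally show ?thesis using assms by (simp add: qcom_commute_iff)
qed

text \<open>The homogenisation of P to degree n, with X standing for A/C. It separates the
  coefficients, which depend on q, from the elements C^(n-j) A^j, which do not: this is the form in
  which limits can be taken, and identities become identities of complex polynomials.\<close>

definition homog :: "nat \<Rightarrow> free_algebra \<Rightarrow> free_algebra \<Rightarrow> complex poly \<Rightarrow> free_algebra" where
  "homog n C A P = (\<Sum>j\<le>n. free_const (coeff P j) * (C ^ (n - j) * A ^ j))"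

lemma homog_carrier [simp]:
  "C \<in> carrier (free_alg N) \<Longrightarrow> A \<in> carrier (free_alg N) \<Longrightarrow> homog n C A P \<in> carrier (free_alg N)"
  by (auto simp: homog_def)

lemma homog_diff: "homog n C A (P - Q) = homog n C A P - homog n C A Q"
  by (simp add: homog_def free_const_hom left_diff_distrib sum_subtractf)

lemma homog_smult: "homog n C A (smult c P) = free_const c * homog n C A P"
  by (simp add: homog_def free_const_hom mult.assoc sum_distrib_left)

lemma homog_Suc: "degree P \<le> n \<Longrightarrow> homog (Suc n) C A P = C * homog n C A P"
  by (simp add: homog_def coeff_eq_0 free_const_hom sum_distrib_left free_const_left_commute[of C]
      Suc_diff_le mult.assoc)

lemma homog_pCons: "homog (Suc n) C A (pCons 0 P) = homog n C A P * A"
  by (simp add: homog_def sum.atMost_Suc_shift free_const_hom sum_distrib_right mult.assoc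
      power_commutes del: sum.atMost_Suc)

lemma homog_monom: "j \<le> n \<Longrightarrow> homog n C A (monom c j) = free_const c * (C ^ (n - j) * A ^ j)"
  by (simp add: homog_def if_distrib[of free_const] if_distrib[of "\<lambda>x. x * _"] free_const_hom
      cong: if_cong)

text \<open>The factor C - cA is the homogenisation of 1 - cX. Commutation of C and A is what lets
  the new A, which arrives on the left, join the powers of A on the right.\<close>

lemma homog_linear_factor:
  assumes "qcom N q 1 C A" "degree P \<le> n"
  shows "fcong N q ((C - free_const c * A) * homog n C A P) (homog (Suc n) C A ([:1, - c:] * P))"
proof -
  have carr [simp]: "C \<in> carrier (free_alg N)" "A \<in> carrier (free_alg N)"
    using assms(1) by (simp_all add: qcom_def)
  have "qcom N q 1 A (homog n C A P)"
  proof -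
    have *: "qcom N q 1 A C" using qcom_sym[OF assms(1)] by simp
    have "qcom N q (1 * (1 ^ (n - j) * 1 ^ j)) A (free_const (coeff P j) * (C ^ (n - j) * A ^ j))" for j
      by (intro qcom_mult_right qcom_power_right * qcom_refl)
         (simp_all add: qcom_commute_iff free_const_commute[of A])
    then show ?thesis unfolding homog_def by (intro qcom_sum_right) simp_all
  qed
  then have "fcong N q (C * homog n C A P - free_const c * (A * homog n C A P))
      (C * homog n C A P - free_const c * (homog n C A P * A))"
    by (intro fcong_diff fcong_const_cancel) (auto simp: qcom_commute_iff)
  moreover have "homog (Suc n) C A ([:1, - c:] * P)
      = C * homog n C A P - free_const c * (homog n C A P * A)"
  proof -
    have "[:1, - c:] * P = P - smult c (pCons 0 P)" by simp
    then show ?thesis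
      using assms(2) by (simp only: homog_diff homog_smult homog_pCons homog_Suc)
  qed
  ultimately show ?thesis by (simp add: left_diff_distrib mult.assoc)
qed

lemma degree_prod_linear: "degree (\<Prod>k<n. [:1, c k::complex:]) \<le> n"
proof (induction n)
  case (Suc n)
  have "degree [:1, c n:] \<le> 1" by simp
  with Suc show ?case
    using degree_mult_le[of "\<Prod>k<n. [:1, c k:]" "[:1, c n:]"] by simp
qed simp

text \<open>In u^(n+1) v^(n+1) the innermost uv is replaced by C - sA and moved left through u^n.
  This leaves C alone and multiplies A by d^n, so each step adds the factor C - s d^n A. The uses
  are s = 1, d = q^(-2) for z_i^n zs_i^n and s = d = q^2 for zs_i^n z_i^n.\<close>

lemma fcong_power_mult_power:
  assumes uv: "fcong N q (u * v) (C - free_const s * A)"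
    and u: "u \<in> carrier (free_alg N)" and v: "v \<in> carrier (free_alg N)"
    and uC: "qcom N q 1 u C" and uA: "qcom N q d u A" and CA: "qcom N q 1 C A"
  shows "fcong N q (u ^ n * v ^ n) (homog n C A (\<Prod>k<n. [:1, - (s * d ^ k):]))"
proof (induction n)
  case 0
  show ?case by (simp add: homog_def free_const_hom)
next
  case (Suc n)
  note carr = u v uC[unfolded qcom_def, THEN conjunct2, THEN conjunct1]
    uA[unfolded qcom_def, THEN conjunct2, THEN conjunct1]
  have "u ^ Suc n * v ^ Suc n = u ^ n * (u * v) * v ^ n"
    by (simp add: power_Suc2[of u] mult.assoc del: power_Suc) (simp add: mult.assoc)
  also have "fcong N q \<dots> (u ^ n * (C - free_const s * A) * v ^ n)"
    using carr uv by (intro fcong_mult_left fcong_mult_right) auto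
  also have "\<dots> = u ^ n * C * v ^ n - free_const s * (u ^ n * A * v ^ n)"
    by (simp add: left_diff_distrib right_diff_distrib free_const_left_commute[of "u ^ n"] mult.assoc)
  also have "fcong N q \<dots> (C * u ^ n * v ^ n - free_const s * (free_const (d ^ n) * (A * u ^ n) * v ^ n))"
    using carr qcom_power_left[OF uC, of n] qcom_power_left[OF uA, of n]
    by (intro fcong_mult_right fcong_const_cancel fcong_diff) (auto simp: qcom_def free_const_hom)
  also have "\<dots> = (C - free_const (s * d ^ n) * A) * (u ^ n * v ^ n)"
    by (simp add: left_diff_distrib free_const_hom mult.assoc)
  also have "fcong N q \<dots> ((C - free_const (s * d ^ n) * A) * homog n C A (\<Prod>k<n. [:1, - (s * d ^ k):]))"
    using carr Suc by (intro fcong_mult_left) auto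
  also have "fcong N q \<dots> (homog (Suc n) C A ([:1, - (s * d ^ n):] * (\<Prod>k<n. [:1, - (s * d ^ k):])))"
    by (rule homog_linear_factor[OF CA degree_prod_linear])
  finally show ?case by (simp add: mult.commute)
qed

lemma fcong_z_power_zs_power:
  assumes "q \<noteq> 0" "i < N"
  shows "fcong N q (fz i ^ n * fzs i ^ n)
    (homog n (head_sum N i) (tail_sum N i) (\<Prod>k<n. [:1, - (inverse (q^2) ^ k):]))"
proof -
  have "fcong N q (fz i * fzs i) (head_sum N i - free_const 1 * tail_sum N i)"
    using assms by (simp add: head_sum_def free_const_hom)
  from fcong_power_mult_power[OF this _ _ qcom_z_head[OF assms] qcom_z_tail qcom_head_tail[OF assms]]
  show ?thesis using assms by simp
qed

lemma fcong_zs_power_z_power: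
  assumes "q \<noteq> 0" "i < N"
  shows "fcong N q (fzs i ^ n * fz i ^ n)
    (homog n (head_sum N i) (tail_sum N i) (\<Prod>k<n. [:1, - ((q^2) ^ Suc k):]))"
  using fcong_power_mult_power[OF fcong_zs_z _ _ qcom_zs_head[OF assms] qcom_zs_tail[OF assms]
      qcom_head_tail[OF assms]] assms by simp

section \<open>A representation by weighted dilations\<close>

type_synonym point = "(nat \<Rightarrow> complex) \<times> (nat \<Rightarrow> complex)"

definition dilate :: "complex \<Rightarrow> nat \<Rightarrow> (nat \<Rightarrow> complex) \<Rightarrow> nat \<Rightarrow> complex" where
  "dilate c i v = (\<lambda>j. if i < j then c * v j else v j)"

lemma dilate_one [simp]: "dilate 1 i v = v"
  by (auto simp: dilate_def)

lemma dilate_dilate [simp]: "dilate c i (dilate d i v) = dilate (c * d) i v"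
  by (auto simp: dilate_def)

lemma dilate_commute: "dilate c i (dilate d j v) = dilate d j (dilate c i v)"
  by (auto simp: dilate_def)

text \<open>The coefficient of \<open>Zs i\<close> is forced by the products: with inverse dilations
  for z_i and zs_i, it makes zs_i z_i multiplication by y_i - q^2 y_(i+1) and z_i zs_i
  multiplication by y_i - y_(i+1), matching C - q^2 A and C - A. The dilation of t yields the
  constants between z_i and z_j, that of y the constants q^(-2) and q^2 against A.\<close>

fun act :: "complex \<Rightarrow> gen \<Rightarrow> (point \<Rightarrow> complex) \<Rightarrow> point \<Rightarrow> complex" where
  "act q (Z i) f (t, y) = t i * f (dilate (inverse q) i t, dilate (inverse (q^2)) i y)"
| "act q (Zs i) f (t, y) = (y i - q^2 * y (Suc i)) / t i * f (dilate q i t, dilate (q^2) i y)"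

definition rho :: "complex \<Rightarrow> free_algebra \<Rightarrow> (point \<Rightarrow> complex) \<Rightarrow> point \<Rightarrow> complex" where
  "rho q p f pt = (\<Sum>w\<in>Poly_Mapping.keys p. Poly_Mapping.lookup p w * foldr (act q) (letters w) f pt)"

text \<open>The coordinate $y_j$ is the value of $\sum_{k\ge j}z_kz_k^*$, which is an empty sum for
  $j\ge N$.\<close>

definition points :: "nat \<Rightarrow> point set" where
  "points N = {(t, y). (\<forall>i. t i \<noteq> 0) \<and> (\<forall>j\<ge>N. y j = 0)}"

lemma act_scale: "act q x (\<lambda>pt. c * f pt) pt = c * act q x f pt"
  by (cases pt; cases x) simp_all

lemma act_add: "act q x (\<lambda>pt. f pt + g pt) pt = act q x f pt + act q x g pt"
  by (cases pt; cases x) (simp_all add: distrib_left)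

lemma foldr_act_scale: "foldr (act q) w (\<lambda>pt. c * f pt) = (\<lambda>pt. c * foldr (act q) w f pt)"
proof (induction w)
  case (Cons x w)
  show ?case by (rule ext) (simp add: Cons act_scale)
qed simp

lemma foldr_act_add:
  "foldr (act q) w (\<lambda>pt. f pt + g pt) = (\<lambda>pt. foldr (act q) w f pt + foldr (act q) w g pt)"
proof (induction w)
  case (Cons x w)
  show ?case by (rule ext) (simp add: Cons act_add)
qed simp

lemma rho_superset:
  assumes "finite S" "Poly_Mapping.keys p \<subseteq> S"
  shows "rho q p f pt = (\<Sum>w\<in>S. Poly_Mapping.lookup p w * foldr (act q) (letters w) f pt)"
  unfolding rho_def using assms by (intro sum.mono_neutral_left) (auto simp: in_keys_iff)

lemma rho_plus: "rho q (a + b) f pt = rho q a f pt + rho q b f pt"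
proof -
  let ?S = "Poly_Mapping.keys a \<union> Poly_Mapping.keys b"
  have "Poly_Mapping.keys (a + b) \<subseteq> ?S" by (rule keys_add)
  then show ?thesis
    by (simp add: rho_superset[of ?S] lookup_add distrib_right sum.distrib)
qed

lemma rho_zero [simp]: "rho q 0 f pt = 0"
  by (simp add: rho_def)

lemma rho_uminus: "rho q (- a) f pt = - rho q a f pt"
  using rho_plus[of q a "- a" f pt] by (simp add: eq_neg_iff_add_eq_0 add.commute)

lemma rho_diff: "rho q (a - b) f pt = rho q a f pt - rho q b f pt"
  using rho_plus[of q a "- b" f pt] by (simp add: rho_uminus)

lemma rho_single: "rho q (Poly_Mapping.single w c) f pt = c * foldr (act q) (letters w) f pt"
  by (simp add: rho_def)

lemma rho_fun_add: "rho q p (\<lambda>pt. f pt + g pt) pt = rho q p f pt + rho q p g pt"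
  by (simp add: rho_def foldr_act_add distrib_left sum.distrib)

lemma rho_mult: "rho q (a * b) f pt = rho q a (rho q b f) pt"
proof (induction a rule: poly_mapping_single_induct)
  case (single u c)
  show ?case
  proof (induction b rule: poly_mapping_single_induct)
    case (single v d)
    show ?case
      by (simp add: mult_single rho_single[abs_def] plus_gword_def foldr_act_scale mult.assoc)
  next
    case (add a b)
    then show ?case by (simp add: distrib_left rho_plus[abs_def] rho_fun_add)
  qed
next
  case (add a b)
  then show ?case by (simp add: distrib_right rho_plus)
qed

lemma rho_const [simp]: "rho q (free_const c) f pt = c * f pt"
  by (simp add: free_const_def rho_single zero_gword_def)

lemma rho_one [simp]: "rho q 1 f pt = f pt"
  using rho_const[of q 1 f pt] by (simp add: free_const_hom)

lemma rho_gen [simp]: "rho q (free_gen x) f = act q x f"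
  by (simp add: free_gen_def rho_single fun_eq_iff)

lemma rho_sum: "rho q (sum p K) f pt = (\<Sum>k\<in>K. rho q (p k) f pt)"
  by (induction K rule: infinite_finite_induct) (simp_all add: rho_plus)

lemma points_dilate: "(t, y) \<in> points N \<Longrightarrow> c \<noteq> 0 \<Longrightarrow> (dilate c i t, dilate d i y) \<in> points N"
  by (auto simp: points_def dilate_def)

lemma act_cong:
  assumes "q \<noteq> 0" "pt \<in> points N" "\<And>pt. pt \<in> points N \<Longrightarrow> f pt = g pt"
  shows "act q x f pt = act q x g pt"
  using assms by (cases pt; cases x) (auto simp: points_dilate)

lemma foldr_act_cong:
  assumes "q \<noteq> 0" "pt \<in> points N" "\<And>pt. pt \<in> points N \<Longrightarrow> f pt = g pt"
  shows "foldr (act q) w f pt = foldr (act q) w g pt"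
  using assms(2)
proof (induction w arbitrary: pt)
  case (Cons x w)
  then show ?case using assms(1) by (auto intro: act_cong)
qed (simp add: assms(3))

text \<open>The relations annihilate functions only at points of \<open>points N\<close>. Since
  dilations preserve this set, a further operator applied from the left cannot see values elsewhere,
  which gives the left absorption in \<open>rho_F_ideal\<close>.\<close>

lemma rho_fun_zero:
  assumes "q \<noteq> 0" "pt \<in> points N" "\<And>pt. pt \<in> points N \<Longrightarrow> f pt = 0"
  shows "rho q p f pt = 0"
proof -
  have "foldr (act q) w f pt = 0" for w
    using foldr_act_cong[OF assms(1,2), of f "\<lambda>_. 0"] foldr_act_scale[of q w 0 "\<lambda>_. 0"] assms(3)
    by simp
  then show ?thesis by (simp add: rho_def)
qed

section \<open>Elements acting as multiplication operators\<close>

definition acts_as :: "nat \<Rightarrow> complex \<Rightarrow> free_algebra \<Rightarrow> (point \<Rightarrow> complex) \<Rightarrow> bool" where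
  "acts_as N q p g \<longleftrightarrow> (\<forall>f. \<forall>pt\<in>points N. rho q p f pt = g pt * f pt)"

lemma acts_asD: "acts_as N q p g \<Longrightarrow> pt \<in> points N \<Longrightarrow> rho q p f pt = g pt * f pt"
  by (simp add: acts_as_def)

lemma acts_as_const: "acts_as N q (free_const c) (\<lambda>_. c)"
  and acts_as_one: "acts_as N q 1 (\<lambda>_. 1)"
  by (simp_all add: acts_as_def)

lemma acts_as_add:
  "acts_as N q a f \<Longrightarrow> acts_as N q b g \<Longrightarrow> acts_as N q (a + b) (\<lambda>pt. f pt + g pt)"
  by (simp add: acts_as_def rho_plus distrib_right)

lemma acts_as_mult:
  "acts_as N q a f \<Longrightarrow> acts_as N q b g \<Longrightarrow> acts_as N q (a * b) (\<lambda>pt. f pt * g pt)"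
  by (simp add: acts_as_def rho_mult mult.assoc)

lemma acts_as_power: "acts_as N q a f \<Longrightarrow> acts_as N q (a ^ n) (\<lambda>pt. f pt ^ n)"
  by (induction n) (auto intro: acts_as_one acts_as_mult)

lemma acts_as_sum:
  "(\<And>k. k \<in> K \<Longrightarrow> acts_as N q (a k) (f k)) \<Longrightarrow> acts_as N q (sum a K) (\<lambda>pt. \<Sum>k\<in>K. f k pt)"
  by (simp add: acts_as_def rho_sum sum_distrib_right)

lemma acts_as_z_zs:
  "q \<noteq> 0 \<Longrightarrow> acts_as N q (fz k * fzs k) (\<lambda>pt. snd pt k - snd pt (Suc k))"
  by (auto simp: acts_as_def rho_mult points_def) (simp add: dilate_def)

lemma acts_as_tail_sum:
  assumes "q \<noteq> 0" "i < N"
  shows "acts_as N q (tail_sum N i) (\<lambda>pt. snd pt (Suc i))"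
proof -
  have "(\<Sum>k\<in>{i<..<N}. y k - y (Suc k)) = y (Suc i)" if "(t, y) \<in> points N" for t y
  proof -
    have "(\<Sum>k\<in>{i<..<N}. y k - y (Suc k)) = - (\<Sum>k=Suc i..<N. y (Suc k) - y k)"
      by (simp add: atLeastSucLessThan_greaterThanLessThan flip: sum_negf)
    also have "\<dots> = y (Suc i) - y N"
      using assms by (subst sum_Suc_diff') auto
    \<comment> \<open>The telescoped sum ends at y_N, which is 0 on \<open>points N\<close>.\<close>
    finally show ?thesis using that by (simp add: points_def)
  qed
  moreover have "acts_as N q (tail_sum N i) (\<lambda>pt. \<Sum>k\<in>{i<..<N}. snd pt k - snd pt (Suc k))"
    unfolding tail_sum_def by (intro acts_as_sum acts_as_z_zs assms)
  ultimately show ?thesis by (fastforce simp: acts_as_def)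
qed

lemma acts_as_head_sum:
  assumes "q \<noteq> 0" "i < N"
  shows "acts_as N q (head_sum N i) (\<lambda>pt. snd pt i)"
  using acts_as_add[OF acts_as_z_zs[OF assms(1), of N i] acts_as_tail_sum[OF assms]]
  by (simp add: head_sum_def)

lemma acts_as_homog:
  assumes "q \<noteq> 0" "i < N"
  shows "acts_as N q (homog n (head_sum N i) (tail_sum N i) P)
    (\<lambda>pt. \<Sum>j\<le>n. coeff P j * (snd pt i ^ (n - j) * snd pt (Suc i) ^ j))"
  unfolding homog_def
  by (intro acts_as_sum acts_as_mult acts_as_const acts_as_power acts_as_head_sum acts_as_tail_sum assms)

lemma rho_F_relations:
  assumes "q \<noteq> 0" "p \<in> F_relations N q" "pt \<in> points N"
  shows "rho q p f pt = 0"
proof -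
  obtain t y where pt: "pt = (t, y)" by (cases pt)
  have t: "t i \<noteq> 0" for i using assms(3) by (simp add: pt points_def)
  have y: "y j = 0" if "j \<ge> N" for j using assms(3) that by (simp add: pt points_def)
  have zz: "act q (Z i) (act q (Z j) f) (t, y) = inverse q * act q (Z j) (act q (Z i) f) (t, y)"
    if "i < j" for i j
    using that assms(1) by (simp add: dilate_commute[of _ i _ j]) (simp add: dilate_def)
  have ss: "act q (Zs i) (act q (Zs j) f) (t, y) = q * act q (Zs j) (act q (Zs i) f) (t, y)"
    if "i < j" for i j
    using that assms(1) t[of i] t[of j]
    by (simp add: dilate_commute[of _ i _ j]) (simp add: dilate_def field_simps power2_eq_square)
  have zs: "act q (Z i) (act q (Zs j) f) (t, y) = inverse q * act q (Zs j) (act q (Z i) f) (t, y)"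
    if "i \<noteq> j" for i j
    using that assms(1) t[of i] t[of j]
    by (cases "i < j"; simp add: dilate_commute[of _ i _ j])
       (auto simp: dilate_def field_simps power2_eq_square)
  have rel: "rho q (fz i * fzs i - fzs i * fz i - free_const (q^2 - 1) * tail_sum N i) f (t, y) = 0"
    if "i < N" for i
    using that assms acts_asD[OF acts_as_tail_sum[OF assms(1) that], of pt f] t[of i]
    by (simp add: rho_diff rho_mult pt) (simp add: dilate_def field_simps power2_eq_square)
  show ?thesis
    using assms(2) zz ss zs rel
    by (auto simp: F_relations_def rho_diff rho_mult pt tail_sum_def)
qed

text \<open>The elements annihilating every function on \<open>points N\<close> form a two-sided
  ideal that contains the relations, hence the ideal generated by them.\<close>

lemma rho_F_ideal:
  assumes "q \<noteq> 0" "p \<in> F_ideal N q" "pt \<in> points N"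
  shows "rho q p f pt = 0"
proof -
  define K where "K = {p \<in> carrier (free_alg N). \<forall>f. \<forall>pt\<in>points N. rho q p f pt = 0}"
  have "ideal K (free_alg N)"
  proof (rule idealI[OF ring_free_alg])
    show "subgroup K (add_monoid (free_alg N))"
    proof
      fix x assume "x \<in> K"
      moreover have "inv\<^bsub>add_monoid (free_alg N)\<^esub> x = - x" if "x \<in> carrier (free_alg N)"
        using free_alg_a_inv[OF that] by (simp add: a_inv_def)
      ultimately show "inv\<^bsub>add_monoid (free_alg N)\<^esub> x \<in> K"
        by (simp add: K_def rho_uminus)
    qed (auto simp: K_def rho_plus)
  next
    fix a x assume "a \<in> K" "x \<in> carrier (free_alg N)"
    then show "x \<otimes>\<^bsub>free_alg N\<^esub> a \<in> K" "a \<otimes>\<^bsub>free_alg N\<^esub> x \<in> K"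
      by (auto simp: K_def rho_mult intro: rho_fun_zero[OF assms(1)])
  qed
  moreover have "F_relations N q \<subseteq> K"
    using F_relations_carrier rho_F_relations[OF assms(1)] by (auto simp: K_def)
  ultimately have "F_ideal N q \<subseteq> K"
    unfolding F_ideal_def by (rule ring.genideal_minimal[OF ring_free_alg])
  with assms show ?thesis by (auto simp: K_def)
qed

lemma rho_fcong:
  "q \<noteq> 0 \<Longrightarrow> fcong N q a b \<Longrightarrow> pt \<in> points N \<Longrightarrow> rho q a f pt = rho q b f pt"
  using rho_F_ideal[of q "a - b" N pt f] by (simp add: fcong_def rho_diff)

text \<open>Each letter moves the evaluation point to one depending on q, so the induction needs
  base points \<open>T q\<close>, \<open>Y q\<close> that already vary continuously with q.\<close>

lemma isCont_foldr_act:
  assumes "\<epsilon> \<noteq> 0"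
    and "\<And>j. isCont (\<lambda>q. T q j) \<epsilon>" "\<And>j. T \<epsilon> j \<noteq> 0" "\<And>j. isCont (\<lambda>q. Y q j) \<epsilon>"
  shows "isCont (\<lambda>q. foldr (act q) w (\<lambda>_. 1) (T q, Y q)) \<epsilon>"
  using assms(2-)
proof (induction w arbitrary: T Y)
  case (Cons x w)
  have dil: "isCont (\<lambda>q. dilate (c q) i (V q) j) \<epsilon>"
    if "isCont c \<epsilon>" "\<And>j. isCont (\<lambda>q. V q j) \<epsilon>" for c V i j
    using that by (cases "i < j") (auto simp: dilate_def)
  have "T \<epsilon> i \<noteq> 0" for i by fact
  then have "dilate c i (T \<epsilon>) j \<noteq> 0" if "c \<noteq> 0" for c i j
    using that by (simp add: dilate_def)
  with Cons.prems assms(1) show ?case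
    by (cases x) (auto intro!: continuous_intros Cons.IH dil)
qed simp

text \<open>The common finite support makes the action a sum over fixed words, in which coefficients
  and operators converge separately.\<close>

lemma rho_limit:
  assumes "\<epsilon> \<noteq> 0" "finite S" "pt \<in> points N"
    and S: "\<forall>\<^sub>F q in at \<epsilon>. Poly_Mapping.keys (r q) \<subseteq> S"
    and lim: "\<And>w. ((\<lambda>q. Poly_Mapping.lookup (r q) w) \<longlongrightarrow> Poly_Mapping.lookup l w) (at \<epsilon>)"
  shows "((\<lambda>q. rho q (r q) (\<lambda>_. 1) pt) \<longlongrightarrow> rho \<epsilon> l (\<lambda>_. 1) pt) (at \<epsilon>)"
proof -
  obtain t y where pt: "pt = (t, y)" by (cases pt)
  have t: "t j \<noteq> 0" for j using assms(3) by (simp add: pt points_def)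
  \<comment> \<open>A word outside S has coefficient 0 for all q near \<epsilon>, so its limit
    coefficient is 0 as well.\<close>
  have "Poly_Mapping.keys l \<subseteq> S"
  proof
    fix w assume w: "w \<in> Poly_Mapping.keys l"
    show "w \<in> S"
    proof (rule ccontr)
      assume "w \<notin> S"
      with S have "\<forall>\<^sub>F q in at \<epsilon>. Poly_Mapping.lookup (r q) w = 0"
        by (auto elim!: eventually_mono simp: in_keys_iff)
      then have "((\<lambda>q. Poly_Mapping.lookup (r q) w) \<longlongrightarrow> 0) (at \<epsilon>)"
        by (rule tendsto_eventually)
      with lim[of w] have "Poly_Mapping.lookup l w = 0"
        using tendsto_unique[of "at \<epsilon>"] by simp
      with w show False by (simp add: in_keys_iff)
    qed
  qed
  moreover have "((\<lambda>q. \<Sum>w\<in>S. Poly_Mapping.lookup (r q) w * foldr (act q) (letters w) (\<lambda>_. 1) pt) \<longlongrightarrow>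
      (\<Sum>w\<in>S. Poly_Mapping.lookup l w * foldr (act \<epsilon>) (letters w) (\<lambda>_. 1) pt)) (at \<epsilon>)"
    using isCont_foldr_act[OF assms(1), of "\<lambda>_. t" "\<lambda>_. y"] t
    by (intro tendsto_sum tendsto_mult lim) (simp add: pt isCont_def)
  moreover have "\<forall>\<^sub>F q in at \<epsilon>. (\<Sum>w\<in>S. Poly_Mapping.lookup (r q) w * foldr (act q) (letters w) (\<lambda>_. 1) pt)
      = rho q (r q) (\<lambda>_. 1) pt"
    using S by eventually_elim (simp add: rho_superset[OF assms(2)])
  ultimately show ?thesis
    by (simp add: rho_superset[OF assms(2)] tendsto_cong)
qed

text \<open>Two families of representatives are congruent for q near \<epsilon> and so act alike
  there; continuity carries this to the limits. Values on the constant function 1 are enough later,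
  because polynomials in the m-th powers act by scalars.\<close>

lemma F_tendsto_rho_unique:
  assumes "\<epsilon> \<noteq> 0" "pt \<in> points N" "a \<in> carrier (free_alg N)" "b \<in> carrier (free_alg N)"
    and "F_tendsto N \<epsilon> f (F_proj N \<epsilon> a)" "F_tendsto N \<epsilon> f (F_proj N \<epsilon> b)"
  shows "rho \<epsilon> a (\<lambda>_. 1) pt = rho \<epsilon> b (\<lambda>_. 1) pt"
proof -
  obtain r l S where r: "finite S" "l \<in> carrier (free_alg N)" "F_proj N \<epsilon> l = F_proj N \<epsilon> a"
    "\<forall>\<^sub>F q in at \<epsilon>. r q \<in> carrier (free_alg N) \<and> Poly_Mapping.keys (r q) \<subseteq> S \<and> F_proj N q (r q) = f q"
    "\<And>w. ((\<lambda>q. Poly_Mapping.lookup (r q) w) \<longlongrightarrow> Poly_Mapping.lookup l w) (at \<epsilon>)"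
    using assms(5) unfolding F_tendsto_def by blast
  obtain r' l' S' where r': "finite S'" "l' \<in> carrier (free_alg N)" "F_proj N \<epsilon> l' = F_proj N \<epsilon> b"
    "\<forall>\<^sub>F q in at \<epsilon>. r' q \<in> carrier (free_alg N) \<and> Poly_Mapping.keys (r' q) \<subseteq> S' \<and> F_proj N q (r' q) = f q"
    "\<And>w. ((\<lambda>q. Poly_Mapping.lookup (r' q) w) \<longlongrightarrow> Poly_Mapping.lookup l' w) (at \<epsilon>)"
    using assms(6) unfolding F_tendsto_def by blast
  have "\<forall>\<^sub>F q in at \<epsilon>. q \<noteq> 0"
    using assms(1) eventually_neq_at_within[of 0 \<epsilon> UNIV] by simp
  with r(4) r'(4) have "\<forall>\<^sub>F q in at \<epsilon>. rho q (r q) (\<lambda>_. 1) pt = rho q (r' q) (\<lambda>_. 1) pt"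
  proof eventually_elim
    case (elim q)
    then have "fcong N q (r q) (r' q)" by (metis F_proj_eq_iff)
    then show ?case using elim assms(2) by (intro rho_fcong) auto
  qed
  moreover have "((\<lambda>q. rho q (r q) (\<lambda>_. 1) pt) \<longlongrightarrow> rho \<epsilon> l (\<lambda>_. 1) pt) (at \<epsilon>)"
    by (rule rho_limit[OF assms(1) r(1) assms(2) _ r(5)]) (use r(4) in eventually_elim, simp)
  moreover have "((\<lambda>q. rho q (r' q) (\<lambda>_. 1) pt) \<longlongrightarrow> rho \<epsilon> l' (\<lambda>_. 1) pt) (at \<epsilon>)"
    by (rule rho_limit[OF assms(1) r'(1) assms(2) _ r'(5)]) (use r'(4) in eventually_elim, simp)
  ultimately have "rho \<epsilon> l (\<lambda>_. 1) pt = rho \<epsilon> l' (\<lambda>_. 1) pt"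
    using tendsto_unique[of "at \<epsilon>"] by (simp add: tendsto_cong)
  moreover have "rho \<epsilon> l (\<lambda>_. 1) pt = rho \<epsilon> a (\<lambda>_. 1) pt"
    using r(2,3) assms by (intro rho_fcong) (simp_all add: F_proj_eq_iff)
  moreover have "rho \<epsilon> l' (\<lambda>_. 1) pt = rho \<epsilon> b (\<lambda>_. 1) pt"
    using r'(2,3) assms by (intro rho_fcong) (simp_all add: F_proj_eq_iff)
  ultimately show ?thesis by simp
qed

lemma rho_z_power:
  "rho q (fz i ^ n) f (t, y)
     = t i ^ n * f (dilate (inverse q ^ n) i t, dilate (inverse (q^2) ^ n) i y)"
  by (induction n arbitrary: t y) (simp_all add: rho_mult, simp_all add: dilate_def mult.commute)

text \<open>Dilation from i on fixes t_i and y_i but multiplies y_(i+1) by q^2 at every application,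
  which produces the successive factors.\<close>

lemma rho_zs_power:
  "rho q (fzs i ^ n) f (t, y)
     = (\<Prod>k<n. y i - (q^2) ^ Suc k * y (Suc i)) / t i ^ n * f (dilate (q ^ n) i t, dilate ((q^2) ^ n) i y)"
proof (induction n arbitrary: f)
  case (Suc n)
  have "rho q (fzs i ^ Suc n) f (t, y) = rho q (fzs i ^ n) (act q (Zs i) f) (t, y)"
    by (simp add: power_Suc2 rho_mult del: power_Suc)
  also have "\<dots> = (\<Prod>k<n. y i - (q^2) ^ Suc k * y (Suc i)) / t i ^ n
      * ((y i - (q^2) ^ Suc n * y (Suc i)) / t i * f (dilate (q ^ Suc n) i t, dilate ((q^2) ^ Suc n) i y))"
    by (subst Suc) (simp, simp add: dilate_def)
  finally show ?case by (simp add: mult.commute)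
qed simp

section \<open>Polynomials in the coordinate functions\<close>

lemma carrier_coord_ring:
  "p \<in> carrier (coord_ring N) \<longleftrightarrow> (\<forall>t \<in> Poly_Mapping.keys p. Poly_Mapping.keys t \<subseteq> gens N)"
  by (simp add: coord_ring_def)

lemma coord_ring_simps [simp]:
  "x \<otimes>\<^bsub>coord_ring N\<^esub> y = x * y" "\<one>\<^bsub>coord_ring N\<^esub> = 1"
  "\<zero>\<^bsub>coord_ring N\<^esub> = 0" "x \<oplus>\<^bsub>coord_ring N\<^esub> y = x + y"
  by (simp_all add: coord_ring_def)

lemma coord_carrier_add [simp]:
  "x \<in> carrier (coord_ring N) \<Longrightarrow> y \<in> carrier (coord_ring N) \<Longrightarrow> x + y \<in> carrier (coord_ring N)"
  using keys_add[of x y] by (force simp: carrier_coord_ring)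

lemma coord_carrier_mult [simp]:
  assumes "x \<in> carrier (coord_ring N)" "y \<in> carrier (coord_ring N)"
  shows "x * y \<in> carrier (coord_ring N)"
  unfolding carrier_coord_ring
proof
  fix w assume "w \<in> Poly_Mapping.keys (x * y)"
  then obtain a b where "w = a + b" "a \<in> Poly_Mapping.keys x" "b \<in> Poly_Mapping.keys y"
    using keys_mult[of x y] by blast
  then show "Poly_Mapping.keys w \<subseteq> gens N"
    using assms keys_add[of a b] by (force simp: carrier_coord_ring)
qed

lemma coord_carrier_const [simp]: "coord_const c \<in> carrier (coord_ring N)"
  by (simp add: carrier_coord_ring coord_const_def)

lemma coord_carrier_coord [simp]: "x \<in> gens N \<Longrightarrow> coord x \<in> carrier (coord_ring N)"
  by (simp add: carrier_coord_ring coord_def)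

lemma coord_const_hom:
  "coord_const 0 = 0" "coord_const 1 = 1" "coord_const (numeral n) = numeral n"
  "coord_const (a + b) = coord_const a + coord_const b"
  "coord_const (- a) = - coord_const a"
  "coord_const (a * b) = coord_const a * coord_const b"
  by (simp_all add: coord_const_def single_add single_uminus mult_single)

lemma coord_carrier_0 [simp]: "0 \<in> carrier (coord_ring N)"
  and coord_carrier_1 [simp]: "1 \<in> carrier (coord_ring N)"
  and coord_carrier_numeral [simp]: "numeral n \<in> carrier (coord_ring N)"
  using coord_carrier_const[of 0 N] coord_carrier_const[of 1 N]
    coord_carrier_const[of "numeral n" N]
  by (simp_all only: coord_const_hom)

lemma coord_carrier_uminus [simp]:
  "x \<in> carrier (coord_ring N) \<Longrightarrow> - x \<in> carrier (coord_ring N)"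
  by (simp add: carrier_coord_ring)

lemma coord_carrier_diff [simp]:
  "x \<in> carrier (coord_ring N) \<Longrightarrow> y \<in> carrier (coord_ring N) \<Longrightarrow> x - y \<in> carrier (coord_ring N)"
  by (simp only: diff_conv_add_uminus coord_carrier_add coord_carrier_uminus)

lemma coord_carrier_sum [simp]:
  "(\<And>k. k \<in> K \<Longrightarrow> f k \<in> carrier (coord_ring N)) \<Longrightarrow> sum f K \<in> carrier (coord_ring N)"
  by (induction K rule: infinite_finite_induct) simp_all

lemma coord_carrier_prod [simp]:
  "(\<And>k. k \<in> K \<Longrightarrow> f k \<in> carrier (coord_ring N)) \<Longrightarrow> prod f K \<in> carrier (coord_ring N)"
  by (induction K rule: infinite_finite_induct) simp_all

lemma coord_carrier_power [simp]:
  "x \<in> carrier (coord_ring N) \<Longrightarrow> x ^ n \<in> carrier (coord_ring N)"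
  by (induction n) simp_all

lemma poly_mapping_sum_single:
  "(p :: 'a \<Rightarrow>\<^sub>0 'b::comm_monoid_add) = (\<Sum>k\<in>Poly_Mapping.keys p. Poly_Mapping.single k (Poly_Mapping.lookup p k))"
  by (rule poly_mapping_eqI) (simp add: lookup_sum lookup_single when_def in_keys_iff)

lemma coord_power: "coord x ^ n = Poly_Mapping.single (Poly_Mapping.single x n) 1"
  by (induction n) (simp_all add: coord_def mult_single flip: single_add)

lemma coord_monomial:
  "Poly_Mapping.single t c = coord_const c * (\<Prod>x\<in>Poly_Mapping.keys t. coord x ^ Poly_Mapping.lookup t x)"
proof -
  have "(\<Prod>x\<in>K. Poly_Mapping.single (s x) (1::complex)) = Poly_Mapping.single (\<Sum>x\<in>K. s x) 1"
    for K and s :: "gen \<Rightarrow> gen \<Rightarrow>\<^sub>0 nat"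
    by (induction K rule: infinite_finite_induct) (simp_all add: mult_single)
  then have "(\<Prod>x\<in>Poly_Mapping.keys t. coord x ^ Poly_Mapping.lookup t x) = Poly_Mapping.single t 1"
    by (simp add: coord_power flip: poly_mapping_sum_single)
  then show ?thesis by (simp add: coord_const_def mult_single)
qed

lemma coord_ring_induct [consumes 1, case_names const coord add mult]:
  assumes "p \<in> carrier (coord_ring N)"
    and const: "\<And>c. Q (coord_const c)" and coord: "\<And>x. x \<in> gens N \<Longrightarrow> Q (coord x)"
    and add: "\<And>f g. f \<in> carrier (coord_ring N) \<Longrightarrow> g \<in> carrier (coord_ring N) \<Longrightarrow>
      Q f \<Longrightarrow> Q g \<Longrightarrow> Q (f + g)"
    and mult: "\<And>f g. f \<in> carrier (coord_ring N) \<Longrightarrow> g \<in> carrier (coord_ring N) \<Longrightarrow>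
      Q f \<Longrightarrow> Q g \<Longrightarrow> Q (f * g)"
  shows "Q p"
proof -
  let ?A = "carrier (coord_ring N)"
  have power: "Q (coord x ^ n)" if "x \<in> gens N" for x n
    using that by (induction n) (use const[of 1] coord in \<open>auto simp: coord_const_hom intro!: mult\<close>)
  have prod: "Q (\<Prod>x\<in>K. coord x ^ s x)" if "K \<subseteq> gens N" for K and s :: "gen \<Rightarrow> nat"
    using that
    by (induction K rule: infinite_finite_induct)
       (use const[of 1] power in \<open>auto simp: coord_const_hom
          intro!: mult coord_carrier_prod coord_carrier_power coord_carrier_coord\<close>)
  have sum: "Q (\<Sum>t\<in>K. Poly_Mapping.single t (Poly_Mapping.lookup p t))"
    if "K \<subseteq> Poly_Mapping.keys p" for K
    using that
  proof (induction K rule: infinite_finite_induct)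
    case (insert t K)
    have t: "Poly_Mapping.keys t \<subseteq> gens N"
      using assms(1) insert.prems by (auto simp: carrier_coord_ring)
    then have "Q (Poly_Mapping.single t (Poly_Mapping.lookup p t))"
      unfolding coord_monomial by (intro mult const prod) (auto intro!: coord_carrier_prod)
    moreover have "Poly_Mapping.single u (Poly_Mapping.lookup p u) \<in> ?A" if "u \<in> insert t K" for u
      using assms(1) insert.prems that by (auto simp: carrier_coord_ring)
    ultimately show ?case using insert by (auto intro!: add)
  qed (use const[of 0] in \<open>simp_all add: coord_const_hom\<close>)
  show ?thesis by (subst poly_mapping_sum_single) (rule sum, simp)
qed

text \<open>The product runs over all generators rather than the support of the monomial, so that
  exponents add factor by factor in \<open>ev_mult\<close>.\<close>

definition ev :: "nat \<Rightarrow> (gen \<Rightarrow> complex) \<Rightarrow> coord_poly \<Rightarrow> complex" where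
  "ev N v p = (\<Sum>t\<in>Poly_Mapping.keys p. Poly_Mapping.lookup p t * (\<Prod>x\<in>gens N. v x ^ Poly_Mapping.lookup t x))"

lemma ev_plus: "ev N v (p + q) = ev N v p + ev N v q"
  using setsum_keys_plus_distrib[of "\<lambda>t c. c * (\<Prod>x\<in>gens N. v x ^ Poly_Mapping.lookup t x)" p q]
  by (simp add: ev_def distrib_right)

lemma ev_single: "ev N v (Poly_Mapping.single t c) = c * (\<Prod>x\<in>gens N. v x ^ Poly_Mapping.lookup t x)"
  by (simp add: ev_def)

lemma ev_mult: "ev N v (p * q) = ev N v p * ev N v q"
proof (induction p rule: poly_mapping_single_induct)
  case (single s c)
  show ?case
  proof (induction q rule: poly_mapping_single_induct)
    case (single t d)
    show ?case by (simp add: mult_single ev_single lookup_add power_add prod.distrib)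
  qed (simp add: ev_plus distrib_left)
qed (simp add: ev_plus distrib_right)

lemma ev_const [simp]: "ev N v (coord_const c) = c"
  by (simp add: coord_const_def ev_single)

lemma ev_zero [simp]: "ev N v 0 = 0"
  by (simp add: ev_def)

lemma ev_coord [simp]: "x \<in> gens N \<Longrightarrow> ev N v (coord x) = v x"
proof -
  assume x: "x \<in> gens N"
  have "(\<Prod>y\<in>gens N. v y ^ (1 when x = y)) = (\<Prod>y\<in>gens N. if x = y then v x else 1)"
    by (rule prod.cong) (auto simp: when_def)
  with x show ?thesis by (simp add: coord_def ev_single lookup_single)
qed

lemma ev_uminus: "ev N v (- p) = - ev N v p"
  using ev_plus[of N v p "- p"] by (simp add: eq_neg_iff_add_eq_0 add.commute)

lemma ev_diff: "ev N v (p - q) = ev N v p - ev N v q"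
  using ev_plus[of N v p "- q"] by (simp add: ev_uminus)

lemma ev_cong: "(\<And>x. x \<in> gens N \<Longrightarrow> v x = v' x) \<Longrightarrow> ev N v p = ev N v' p"
  unfolding ev_def by (intro sum.cong arg_cong2[of _ _ _ _ "(*)"] prod.cong) auto

text \<open>Distinct monomials are distinct characters of a torus, hence linearly independent.\<close>

lemma monomials_independent:
  assumes "finite T" "\<And>t. t \<in> T \<Longrightarrow> Poly_Mapping.keys t \<subseteq> gens N"
    and "\<And>v. (\<And>x. v x \<noteq> 0) \<Longrightarrow> (\<Sum>t\<in>T. c t * (\<Prod>x\<in>gens N. v x ^ Poly_Mapping.lookup t x)) = (0::complex)"
    and "t \<in> T"
  shows "c t = 0"
proof -
  define \<chi> where "\<chi> t v = (\<Prod>x\<in>gens N. v x ^ Poly_Mapping.lookup t x)"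
    for t and v :: "gen \<Rightarrow> complex"
  have \<chi>_mult: "\<chi> t (\<lambda>x. v x * w x) = \<chi> t v * \<chi> t w" for t v w
    by (simp add: \<chi>_def power_mult_distrib prod.distrib)
  have "\<And>c t. \<lbrakk>\<And>t. t \<in> T \<Longrightarrow> Poly_Mapping.keys t \<subseteq> gens N;
      \<And>v. (\<And>x. v x \<noteq> 0) \<Longrightarrow> (\<Sum>t\<in>T. c t * \<chi> t v) = 0; t \<in> T\<rbrakk> \<Longrightarrow> c t = 0"
    using assms(1)
  proof (induction T rule: finite_induct)
    case (insert s T)
    note rel = insert.prems(2)
    have T: "c u = 0" if "u \<in> T" for u
    proof -
      from that insert.hyps have "u \<noteq> s" by auto
      then obtain x where x: "Poly_Mapping.lookup u x \<noteq> Poly_Mapping.lookup s x"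
        unfolding poly_mapping_eq_iff fun_eq_iff by blast
      then have xg: "x \<in> gens N"
      proof -
        have "x \<in> Poly_Mapping.keys u \<or> x \<in> Poly_Mapping.keys s"
          using x unfolding in_keys_iff by linarith
        then show ?thesis using insert.prems(1)[of u] insert.prems(1)[of s] that by blast
      qed
      \<comment> \<open>The exponents of u and s differ at x, and distinct powers of 2 are distinct,
        so \<open>v0\<close> separates the characters of u and s.\<close>
      define v0 where "v0 = (\<lambda>y. if y = x then 2 else 1 :: complex)"
      have v0: "v0 y \<noteq> 0" for y by (simp add: v0_def)
      have \<chi>v0: "\<chi> r v0 = 2 ^ Poly_Mapping.lookup r x" for r
      proof -
        have "\<chi> r v0 = (\<Prod>y\<in>gens N. if y = x then 2 ^ Poly_Mapping.lookup r x else 1)"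
          unfolding \<chi>_def by (rule prod.cong) (auto simp: v0_def)
        with xg show ?thesis by simp
      qed
      \<comment> \<open>Dedekind's argument: the relation at the translate of v by
        \<open>v0\<close>, minus \<open>\<chi> s v0\<close> times the relation at v, no longer
        contains s, so the induction hypothesis applies to it.\<close>
      have "c u * (\<chi> u v0 - \<chi> s v0) = 0"
      proof (rule insert.IH[OF _ _ that])
        fix v :: "gen \<Rightarrow> complex" assume v: "\<And>x. v x \<noteq> 0"
        have "(\<Sum>t\<in>T. c t * (\<chi> t v0 - \<chi> s v0) * \<chi> t v)
            = (\<Sum>t\<in>insert s T. c t * (\<chi> t v0 - \<chi> s v0) * \<chi> t v)"
          using insert.hyps by simp
        also have "\<dots> = (\<Sum>t\<in>insert s T. c t * \<chi> t (\<lambda>x. v x * v0 x) - \<chi> s v0 * (c t * \<chi> t v))"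
          by (rule sum.cong[OF refl]) (simp only: \<chi>_mult, simp add: algebra_simps)
        also have "\<dots> = 0"
          using rel[of "\<lambda>x. v x * v0 x"] rel[of v] v v0
          by (simp only: sum_subtractf sum_distrib_left[symmetric]) simp
        finally show "(\<Sum>t\<in>T. c t * (\<chi> t v0 - \<chi> s v0) * \<chi> t v) = 0" .
      qed (use insert.prems(1) in auto)
      moreover have "(2::complex) ^ Poly_Mapping.lookup u x \<noteq> 2 ^ Poly_Mapping.lookup s x"
      proof
        assume "(2::complex) ^ Poly_Mapping.lookup u x = 2 ^ Poly_Mapping.lookup s x"
        then have "norm ((2::complex) ^ Poly_Mapping.lookup u x) = norm ((2::complex) ^ Poly_Mapping.lookup s x)"
          by simp
        with x show False by (simp add: norm_power)
      qed
      ultimately show ?thesis by (simp add: \<chi>v0)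
    qed
    moreover have "c s = 0"
    proof -
      have "(\<Sum>t\<in>T. c t * \<chi> t (\<lambda>_. 1)) = 0"
        using T by (intro sum.neutral) simp
      moreover have "\<chi> s (\<lambda>_. 1) = 1" by (simp add: \<chi>_def)
      ultimately show ?thesis
        using rel[of "\<lambda>_. 1"] insert.hyps by simp
    qed
    ultimately show ?case using insert.prems(3) by auto
  qed simp
  then show ?thesis using assms(2-4) unfolding \<chi>_def by blast
qed

lemma ev_eq_0D:
  assumes "p \<in> carrier (coord_ring N)" "\<And>v. (\<And>x. v x \<noteq> 0) \<Longrightarrow> ev N v p = 0"
  shows "p = 0"
proof -
  have "Poly_Mapping.lookup p t = 0" if "t \<in> Poly_Mapping.keys p" for t
    by (rule monomials_independent[OF _ _ _ that, of N])
       (use assms in \<open>auto simp: ev_def carrier_coord_ring\<close>)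
  then show ?thesis by (intro poly_mapping_eqI) (metis in_keys_iff lookup_zero)
qed

text \<open>The scalars by which the m-th powers of the generators act at (t, y) for q = \<epsilon>:
  the dilations by \<epsilon>^m and \<epsilon>^(2m) are trivial, and only the prefactors in
  \<open>rho_z_power\<close> and \<open>rho_zs_power\<close> remain.\<close>

fun central_char :: "nat \<Rightarrow> complex \<Rightarrow> point \<Rightarrow> gen \<Rightarrow> complex" where
  "central_char m \<epsilon> (t, y) (Z i) = t i ^ m"
| "central_char m \<epsilon> (t, y) (Zs i) = (\<Prod>k<m. y i - (\<epsilon>^2) ^ Suc k * y (Suc i)) / t i ^ m"

text \<open>A complex polynomial of positive degree takes every value.\<close>

lemma prod_shift_surj:
  fixes a :: "nat \<Rightarrow> complex"
  assumes "m > 0"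
  shows "\<exists>z. (\<Prod>k<m. z - a k) = c"
proof -
  let ?p = "(\<Prod>k<m. [:- a k, 1:]) + [:- c:]"
  have "degree (\<Prod>k<m. [:- a k, 1:]) = m"
    by (subst degree_prod_eq_sum_degree) auto
  then have "degree ?p = m"
    using assms degree_add_eq_left[of "[:- c:]" "\<Prod>k<m. [:- a k, 1:]"] by simp
  then obtain z where "poly ?p z = 0"
    using assms fundamental_theorem_of_algebra[of ?p] by (auto simp: constant_degree)
  then show ?thesis by (auto simp: poly_prod intro!: exI[of _ z])
qed

text \<open>The t_i are m-th roots of prescribed values. The y_i are then found downwards from y_N =
  0: once y_(i+1) is known, the condition at i is a polynomial equation of degree m for y_i. In the
  induction n counts the top indices already treated.\<close>

lemma central_char_surj:
  fixes v :: "gen \<Rightarrow> complex"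
  assumes "m > 0" "\<And>x. v x \<noteq> 0"
  shows "\<exists>pt\<in>points N. \<forall>x\<in>gens N. central_char m \<epsilon> pt x = v x"
proof -
  have "\<exists>z. z ^ m = v (Z i)" for i
    using prod_shift_surj[OF assms(1), of "\<lambda>_. 0"] by simp
  then obtain t where t: "t i ^ m = v (Z i)" for i by metis
  have t0: "t i \<noteq> 0" for i using t[of i] assms(2)[of "Z i"] assms(1) by (auto simp: zero_power)
  have "\<exists>y. (\<forall>j\<ge>N. y j = 0) \<and>
      (\<forall>i<N. N \<le> i + n \<longrightarrow> (\<Prod>k<m. y i - (\<epsilon>^2) ^ Suc k * y (Suc i)) = v (Z i) * v (Zs i))" for n
  proof (induction n)
    case 0
    show ?case by (auto intro!: exI[of _ "\<lambda>_. 0"])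
  next
    case (Suc n)
    then obtain y where y: "\<forall>j\<ge>N. y j = 0"
      "\<forall>i<N. N \<le> i + n \<longrightarrow> (\<Prod>k<m. y i - (\<epsilon>^2) ^ Suc k * y (Suc i)) = v (Z i) * v (Zs i)"
      by blast
    show ?case
    proof (cases "Suc n \<le> N")
      case True
      define i where "i = N - Suc n"
      obtain z where z: "(\<Prod>k<m. z - (\<epsilon>^2) ^ Suc k * y (Suc i)) = v (Z i) * v (Zs i)"
        using prod_shift_surj[OF assms(1), of "\<lambda>k. (\<epsilon>^2) ^ Suc k * y (Suc i)"] by metis
      have "(\<Prod>k<m. (y(i := z)) j - (\<epsilon>^2) ^ Suc k * (y(i := z)) (Suc j)) = v (Z j) * v (Zs j)"
        if "j < N" "N \<le> j + Suc n" for j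
      proof (cases "j = i")
        case False
        with that True have "N \<le> j + n" "Suc j \<noteq> i" by (auto simp: i_def)
        with False y(2) that(1) show ?thesis by simp
      qed (use z in simp)
      then show ?thesis
        using y(1) True by (intro exI[of _ "y(i := z)"]) (auto simp: i_def)
    next
      case False
      with y show ?thesis by (intro exI[of _ y]) auto
    qed
  qed
  from this[of N] obtain y where y: "\<forall>j\<ge>N. y j = 0"
    "\<forall>i<N. (\<Prod>k<m. y i - (\<epsilon>^2) ^ Suc k * y (Suc i)) = v (Z i) * v (Zs i)" by auto
  have "(t, y) \<in> points N" using t0 y by (simp add: points_def)
  moreover have "central_char m \<epsilon> (t, y) x = v x" if "x \<in> gens N" for x
    using that y(2) t t0 assms(2) by (cases x) (auto simp: divide_eq_eq mult.commute)
  ultimately show ?thesis by blast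
qed

section \<open>The correspondence with central elements\<close>

lemma primitive_rootD:
  assumes "primitive_root_of_unity m \<epsilon>"
  shows "m > 0" "\<epsilon> ^ m = 1" "\<epsilon> \<noteq> 0"
  using assms by (auto simp: primitive_root_of_unity_def zero_power)

lemma qcom_power_root:
  assumes "\<epsilon> ^ m = 1" "qcom N \<epsilon> \<epsilon> x y"
  shows "qcom N \<epsilon> 1 (x ^ m) (y ^ m)"
  using qcom_power[OF assms(2), of m m] assms(1) by (simp add: power_mult)

lemma power_inverse_root:
  "c ^ m = 1 \<Longrightarrow> k \<le> m \<Longrightarrow> inverse c ^ k = (c::complex) ^ (m - k)"
  by (metis inverse_unique le_add_diff_inverse mult.commute power_add power_inverse)

text \<open>The substitution of m - k for k turns the exponents 0, ..., -(m-1) into m, ..., 1 modulo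
  m. This is why z_i^m and zs_i^m commute at \<epsilon>.\<close>

lemma prod_linear_reindex:
  assumes "c ^ m = (1::complex)"
  shows "(\<Prod>k<m. [:1, - (inverse c ^ k):]) = (\<Prod>k<m. [:1, - (c ^ Suc k):])"
proof -
  have "(\<Prod>k<m. [:1, - (c ^ Suc k):]) = (\<Prod>k<m. [:1, - (c ^ Suc (m - Suc k)):])"
    by (rule prod.nat_diff_reindex[symmetric])
  also have "\<dots> = (\<Prod>k<m. [:1, - (inverse c ^ k):])"
    using assms by (intro prod.cong refl) (simp add: power_inverse_root Suc_diff_Suc)
  finally show ?thesis by simp
qed

text \<open>Pairwise commutation is the part of centrality that the correspondence needs: it makes
  substitution of m-th powers multiplicative. For different generators other than a pair z_i, zs_i
  the constant is a power of \<epsilon>^m.\<close>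

lemma qcom_gen_powers:
  assumes "\<epsilon> ^ m = 1" "\<epsilon> \<noteq> 0" "x \<in> gens N" "y \<in> gens N"
  shows "qcom N \<epsilon> 1 (free_gen x ^ m) (free_gen y ^ m)"
proof -
  have sym: "qcom N \<epsilon> 1 b a" if "qcom N \<epsilon> 1 a b" for a b
    using qcom_sym[OF that] by simp
  have inv: "qcom N \<epsilon> 1 (a ^ m) (b ^ m)" if "qcom N \<epsilon> (inverse \<epsilon>) a b" for a b
    using sym[OF qcom_power_root[OF assms(1)]] qcom_sym[OF that] assms(2) by simp
  have zz: "qcom N \<epsilon> 1 (fz i ^ m) (fz j ^ m)" if "i < N" "j < N" for i j
    using that qcom_z_z[of i j N \<epsilon>] qcom_z_z[of j i N \<epsilon>]
    by (cases i j rule: linorder_cases) (auto intro: sym inv qcom_refl)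
  have ss: "qcom N \<epsilon> 1 (fzs i ^ m) (fzs j ^ m)" if "i < N" "j < N" for i j
    using that qcom_zs_zs[of i j N \<epsilon>] qcom_zs_zs[of j i N \<epsilon>]
    by (cases i j rule: linorder_cases)
       (auto intro: sym qcom_power_root[OF assms(1)] qcom_refl)
  have zs: "qcom N \<epsilon> 1 (fz i ^ m) (fzs j ^ m)" if "i < N" "j < N" for i j
  proof (cases "i = j")
    case True
    have "(\<epsilon>\<^sup>2) ^ m = 1" using assms(1) by (metis power_mult mult.commute power_one)
    then have "fcong N \<epsilon> (fz i ^ m * fzs i ^ m) (fzs i ^ m * fz i ^ m)"
      using fcong_trans[OF fcong_z_power_zs_power[of \<epsilon> i N m]]
        fcong_sym[OF fcong_zs_power_z_power[of \<epsilon> i N m]]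
        assms(2) that prod_linear_reindex[of "\<epsilon>^2" m] by simp
    then show ?thesis using True that by (simp add: qcom_commute_iff)
  qed (use that in \<open>auto intro: inv qcom_z_zs\<close>)
  show ?thesis
    using assms(3,4) zz ss zs sym by (cases x; cases y) auto
qed

text \<open>A monomial in noncommuting factors needs a fixed order; at \<epsilon> the order of the
  m-th powers is immaterial modulo the ideal.\<close>

definition gens_list :: "nat \<Rightarrow> gen list" where
  "gens_list N = map Z [0..<N] @ map Zs [0..<N]"

lemma set_gens_list [simp]: "set (gens_list N) = gens N"
  and distinct_gens_list [simp]: "distinct (gens_list N)"
  by (auto simp: gens_list_def gens_def distinct_map inj_on_def)

definition power_monomial :: "nat \<Rightarrow> nat \<Rightarrow> (gen \<Rightarrow>\<^sub>0 nat) \<Rightarrow> free_algebra" where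
  "power_monomial N m t = prod_list (map (\<lambda>x. (free_gen x ^ m) ^ Poly_Mapping.lookup t x) (gens_list N))"

text \<open>Lifts the correspondence to representatives: additive in the free algebra itself,
  multiplicative only modulo the ideal at \<epsilon>.\<close>

definition power_subst :: "nat \<Rightarrow> nat \<Rightarrow> coord_poly \<Rightarrow> free_algebra" where
  "power_subst N m P = (\<Sum>t\<in>Poly_Mapping.keys P. free_const (Poly_Mapping.lookup P t) * power_monomial N m t)"

lemma power_monomial_carrier [simp]: "power_monomial N m t \<in> carrier (free_alg N)"
  by (auto simp: power_monomial_def)

lemma power_subst_carrier [simp]: "power_subst N m P \<in> carrier (free_alg N)"
  by (auto simp: power_subst_def)

lemma power_subst_add: "power_subst N m (P + Q) = power_subst N m P + power_subst N m Q"
  using setsum_keys_plus_distrib[of "\<lambda>t c. free_const c * power_monomial N m t" P Q]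
  by (simp add: power_subst_def free_const_hom distrib_right)

lemma power_subst_zero [simp]: "power_subst N m 0 = 0"
  by (simp add: power_subst_def)

lemma power_subst_sum: "power_subst N m (sum f K) = (\<Sum>k\<in>K. power_subst N m (f k))"
  by (induction K rule: infinite_finite_induct) (simp_all add: power_subst_add)

lemma power_subst_single:
  "power_subst N m (Poly_Mapping.single t c) = free_const c * power_monomial N m t"
  by (simp add: power_subst_def free_const_hom)

lemma prod_list_ones: "prod_list (map (\<lambda>_. 1) xs) = (1::'a::monoid_mult)"
  by (induction xs) simp_all

lemma power_monomial_zero: "power_monomial N m 0 = 1"
  by (simp add: power_monomial_def prod_list_ones)

lemma power_subst_const: "power_subst N m (coord_const c) = free_const c"
  by (simp add: coord_const_def power_subst_single power_monomial_zero)

lemma power_subst_one: "power_subst N m 1 = 1"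
  using power_subst_const[of N m 1] by (simp add: coord_const_hom free_const_hom)

lemma prod_list_delta:
  "distinct xs \<Longrightarrow> x \<in> set xs \<Longrightarrow> prod_list (map (\<lambda>y. if y = x then a else 1) xs) = (a::'a::monoid_mult)"
proof (induction xs)
  case (Cons z xs)
  show ?case
  proof (cases "z = x")
    case True
    then have "map (\<lambda>y. if y = x then a else 1) xs = map (\<lambda>_. 1) xs"
      using Cons.prems by auto
    then have "prod_list (map (\<lambda>y. if y = x then a else 1) xs) = 1"
      by (simp only: prod_list_ones)
    then show ?thesis using True by simp
  qed (use Cons in auto)
qed simp

lemma power_subst_coord:
  assumes "x \<in> gens N"
  shows "power_subst N m (coord x) = free_gen x ^ m"
proof -
  have "(free_gen y ^ m) ^ Poly_Mapping.lookup (Poly_Mapping.single x (1::nat)) y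
      = (if y = x then free_gen x ^ m else 1)" for y
    by (auto simp: lookup_single when_def)
  then have "power_monomial N m (Poly_Mapping.single x 1) = free_gen x ^ m"
    unfolding power_monomial_def using assms by (simp only: prod_list_delta distinct_gens_list set_gens_list)
  then show ?thesis by (simp add: coord_def power_subst_single free_const_hom)
qed

text \<open>Interleaves the two products: the second power of the head generator is moved left
  across the first product of the tail.\<close>

lemma fcong_prod_list_power_add:
  assumes "\<And>x y. x \<in> set xs \<Longrightarrow> y \<in> set xs \<Longrightarrow> qcom N q 1 (g x) (g y)"
  shows "fcong N q (prod_list (map (\<lambda>x. g x ^ (s x + t x)) xs))
    (prod_list (map (\<lambda>x. g x ^ s x) xs) * prod_list (map (\<lambda>x. g x ^ t x) xs))"
  using assms
proof (induction xs)
  case (Cons x xs)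
  note comm_gens = Cons.prems
  have g: "g y \<in> carrier (free_alg N)" if "y \<in> set (x # xs)" for y
    using Cons.prems[OF that that] by (simp add: qcom_def)
  define S where "S = prod_list (map (\<lambda>x. g x ^ s x) xs)"
  define T where "T = prod_list (map (\<lambda>x. g x ^ t x) xs)"
  have ST [simp]: "S \<in> carrier (free_alg N)" "T \<in> carrier (free_alg N)"
    using g by (auto simp: S_def T_def)
  have gx [simp]: "g x \<in> carrier (free_alg N)" using g by simp
  have "qcom N q 1 (g x ^ t x) (prod_list (map (\<lambda>x. g x ^ s x) ys))" if "set ys \<subseteq> set xs" for ys
    using that
  proof (induction ys)
    case (Cons y ys)
    have "qcom N q (1 ^ (t x * s y)) (g x ^ t x) (g y ^ s y)"
      using Cons.prems by (intro qcom_power) (use comm_gens in auto)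
    then show ?case using qcom_mult_right[OF _ Cons.IH] Cons.prems by simp
  qed (simp add: qcom_one_right)
  then have "qcom N q 1 (g x ^ t x) S" by (simp add: S_def)
  then have comm: "fcong N q (S * g x ^ t x) (g x ^ t x * S)"
    using fcong_sym by (auto simp: qcom_commute_iff)
  have "fcong N q (g x ^ s x * g x ^ t x * prod_list (map (\<lambda>x. g x ^ (s x + t x)) xs))
      (g x ^ s x * g x ^ t x * (S * T))"
    using Cons unfolding S_def T_def by (intro fcong_mult_left) auto
  also have "g x ^ s x * g x ^ t x * (S * T) = g x ^ s x * ((g x ^ t x * S) * T)"
    by (simp add: mult.assoc)
  also have "fcong N q \<dots> (g x ^ s x * ((S * g x ^ t x) * T))"
    using comm by (intro fcong_mult_left fcong_mult_right) (auto intro: fcong_sym)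
  finally show ?case by (simp add: S_def T_def power_add mult.assoc)
qed simp

lemma power_subst_mult:
  assumes "\<epsilon> ^ m = 1" "\<epsilon> \<noteq> 0"
  shows "fcong N \<epsilon> (power_subst N m (P * Q)) (power_subst N m P * power_subst N m Q)"
proof (induction P rule: poly_mapping_single_induct)
  case (single s c)
  show ?case
  proof (induction Q rule: poly_mapping_single_induct)
    case (single t d)
    have "fcong N \<epsilon> (power_monomial N m (s + t)) (power_monomial N m s * power_monomial N m t)"
      unfolding power_monomial_def lookup_add
      by (rule fcong_prod_list_power_add) (use qcom_gen_powers[OF assms] in auto)
    then have "fcong N \<epsilon> (free_const (c * d) * power_monomial N m (s + t))
        (free_const (c * d) * (power_monomial N m s * power_monomial N m t))"
      by (rule fcong_const_cancel)
    also have "free_const (c * d) * (power_monomial N m s * power_monomial N m t)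
        = (free_const c * power_monomial N m s) * (free_const d * power_monomial N m t)"
      by (simp add: free_const_hom mult.assoc free_const_left_commute[of "power_monomial N m s"])
    finally show ?case by (simp add: mult_single power_subst_single)
  qed (simp add: power_subst_add distrib_left fcong_add)
qed (simp add: power_subst_add distrib_right fcong_add)

lemma coord_correspondence_power_subst:
  assumes "\<epsilon> ^ m = 1" "\<epsilon> \<noteq> 0"
  shows "coord_correspondence N m \<epsilon> (\<lambda>P. F_proj N \<epsilon> (power_subst N m P))"
  unfolding coord_correspondence_def
proof (intro conjI allI ballI ring_hom_memI)
  fix P Q :: coord_poly
  show "F_proj N \<epsilon> (power_subst N m (P \<otimes>\<^bsub>coord_ring N\<^esub> Q)) =
      F_proj N \<epsilon> (power_subst N m P) \<otimes>\<^bsub>F_alg N \<epsilon>\<^esub> F_proj N \<epsilon> (power_subst N m Q)"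
    using power_subst_mult[OF assms] by (simp add: F_proj_mult F_proj_eq_iff)
  show "F_proj N \<epsilon> (power_subst N m (P \<oplus>\<^bsub>coord_ring N\<^esub> Q)) =
      F_proj N \<epsilon> (power_subst N m P) \<oplus>\<^bsub>F_alg N \<epsilon>\<^esub> F_proj N \<epsilon> (power_subst N m Q)"
    by (simp add: F_proj_add power_subst_add)
qed (simp_all add: F_proj_one power_subst_one power_subst_const F_const_def power_subst_coord
    F_gen_def F_proj_pow)

lemma acts_as_gen_power:
  assumes "\<epsilon> ^ m = 1" "x \<in> gens N"
  shows "acts_as N \<epsilon> (free_gen x ^ m) (\<lambda>pt. central_char m \<epsilon> pt x)"
proof -
  have "(\<epsilon>\<^sup>2) ^ m = 1" using assms(1) by (metis power_mult mult.commute power_one)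
  then show ?thesis
    using assms by (cases x) (auto simp: acts_as_def rho_z_power rho_zs_power power_inverse)
qed

text \<open>Concerns an arbitrary correspondence, because \<open>induced_bracket\<close> only
  asserts that some \<phi> exists. As a homomorphism it is controlled by constants and coordinate
  functions, whose images act by scalars.\<close>

lemma coord_correspondence_acts_as:
  assumes root: "\<epsilon> ^ m = 1" and \<phi>: "coord_correspondence N m \<epsilon> \<phi>"
    and P: "P \<in> carrier (coord_ring N)"
  shows "\<exists>a\<in>carrier (free_alg N). \<phi> P = F_proj N \<epsilon> a \<and>
    acts_as N \<epsilon> a (\<lambda>pt. ev N (central_char m \<epsilon> pt) P)"
  using P
proof (induction P rule: coord_ring_induct)
  case (const c)
  then show ?case
    using \<phi> acts_as_const by (auto simp: coord_correspondence_def F_const_def)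
next
  case (coord x)
  then show ?case
    using \<phi> acts_as_gen_power[OF root coord] free_carrier_gen[OF coord]
    by (auto simp: coord_correspondence_def F_gen_def F_proj_pow intro!: bexI[of _ "free_gen x ^ m"])
next
  case (add f g)
  then obtain a b where "a \<in> carrier (free_alg N)" "\<phi> f = F_proj N \<epsilon> a"
    "acts_as N \<epsilon> a (\<lambda>pt. ev N (central_char m \<epsilon> pt) f)"
    "b \<in> carrier (free_alg N)" "\<phi> g = F_proj N \<epsilon> b"
    "acts_as N \<epsilon> b (\<lambda>pt. ev N (central_char m \<epsilon> pt) g)" by blast
  then show ?case
    using \<phi> add.hyps ring_hom_add[of \<phi> "coord_ring N" "F_alg N \<epsilon>" f g]
    by (auto simp: coord_correspondence_def F_proj_add ev_plus intro!: bexI[of _ "a + b"] acts_as_add)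
next
  case (mult f g)
  then obtain a b where "a \<in> carrier (free_alg N)" "\<phi> f = F_proj N \<epsilon> a"
    "acts_as N \<epsilon> a (\<lambda>pt. ev N (central_char m \<epsilon> pt) f)"
    "b \<in> carrier (free_alg N)" "\<phi> g = F_proj N \<epsilon> b"
    "acts_as N \<epsilon> b (\<lambda>pt. ev N (central_char m \<epsilon> pt) g)" by blast
  then show ?case
    using \<phi> mult.hyps ring_hom_mult[of \<phi> "coord_ring N" "F_alg N \<epsilon>" f g]
    by (auto simp: coord_correspondence_def F_proj_mult ev_mult intro!: bexI[of _ "a * b"] acts_as_mult)
qed

section \<open>Uniqueness of the polynomial expressing a limit\<close>

definition bracket_quotient :: "nat \<Rightarrow> nat \<Rightarrow> gen \<Rightarrow> gen \<Rightarrow> complex \<Rightarrow> free_algebra set" where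
  "bracket_quotient N m x y q = F_const N q (1 / (of_nat m * (q ^ m - 1))) \<otimes>\<^bsub>F_alg N q\<^esub>
     F_commutator N q (F_gen N q x [^]\<^bsub>F_alg N q\<^esub> m) (F_gen N q y [^]\<^bsub>F_alg N q\<^esub> m)"

lemma bracket_quotient_eq:
  assumes "x \<in> gens N" "y \<in> gens N"
  shows "bracket_quotient N m x y q = F_proj N q (free_const (1 / (of_nat m * (q ^ m - 1))) *
    (free_gen x ^ m * free_gen y ^ m - free_gen y ^ m * free_gen x ^ m))"
  using assms free_carrier_gen[of x N] free_carrier_gen[of y N]
  by (simp add: bracket_quotient_def F_const_def F_commutator_def F_gen_def F_proj_pow F_proj_mult
      F_proj_minus)

lemma induced_bracketI:
  assumes "\<epsilon> ^ m = 1" "\<epsilon> \<noteq> 0" "P \<in> carrier (coord_ring N)"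
    and "F_tendsto N \<epsilon> (bracket_quotient N m x y) (F_proj N \<epsilon> l)"
    and "fcong N \<epsilon> l (power_subst N m P)"
  shows "induced_bracket N m \<epsilon> x y P"
proof -
  have "F_proj N \<epsilon> l = F_proj N \<epsilon> (power_subst N m P)"
    using assms(5) by (simp add: F_proj_eq_iff fcong_carrier)
  then show ?thesis
    using assms(3,4) coord_correspondence_power_subst[OF assms(1,2), of N]
    by (auto simp: induced_bracket_def bracket_quotient_def[abs_def])
qed

text \<open>Reads the values of P off any representative l of the limit, even one that is no
  polynomial in the m-th powers. Both uniqueness and the obstruction for even m rest on
  this.\<close>

lemma induced_bracket_ev:
  assumes "\<epsilon> ^ m = 1" "\<epsilon> \<noteq> 0" "induced_bracket N m \<epsilon> x y P"
    and "F_tendsto N \<epsilon> (bracket_quotient N m x y) (F_proj N \<epsilon> l)" "l \<in> carrier (free_alg N)"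
    and "pt \<in> points N"
  shows "ev N (central_char m \<epsilon> pt) P = rho \<epsilon> l (\<lambda>_. 1) pt"
proof -
  obtain \<phi> where P: "P \<in> carrier (coord_ring N)" and \<phi>: "coord_correspondence N m \<epsilon> \<phi>"
    and lim: "F_tendsto N \<epsilon> (bracket_quotient N m x y) (\<phi> P)"
    using assms(3) unfolding induced_bracket_def bracket_quotient_def[abs_def] by blast
  obtain a where a: "a \<in> carrier (free_alg N)" "\<phi> P = F_proj N \<epsilon> a"
    "acts_as N \<epsilon> a (\<lambda>pt. ev N (central_char m \<epsilon> pt) P)"
    using coord_correspondence_acts_as[OF assms(1) \<phi> P] by blast
  have "rho \<epsilon> a (\<lambda>_. 1) pt = rho \<epsilon> l (\<lambda>_. 1) pt"
    using a lim assms by (intro F_tendsto_rho_unique[where f = "bracket_quotient N m x y"]) auto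
  with acts_asD[OF a(3) assms(6), of "\<lambda>_. 1"] show ?thesis by simp
qed

text \<open>P and Q take the values prescribed by one and the same limit at all central characters,
  and these fill the torus, where a polynomial is determined by its values.\<close>

lemma induced_bracket_unique:
  assumes "m > 0" "\<epsilon> ^ m = 1" "\<epsilon> \<noteq> 0"
    and P: "induced_bracket N m \<epsilon> x y P" and Q: "induced_bracket N m \<epsilon> x y Q"
  shows "P = Q"
proof -
  obtain \<phi> where carr: "P \<in> carrier (coord_ring N)" and \<phi>: "coord_correspondence N m \<epsilon> \<phi>"
    and lim: "F_tendsto N \<epsilon> (bracket_quotient N m x y) (\<phi> P)"
    using P unfolding induced_bracket_def bracket_quotient_def[abs_def] by blast
  obtain a where a: "a \<in> carrier (free_alg N)" "\<phi> P = F_proj N \<epsilon> a"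
    using coord_correspondence_acts_as[OF assms(2) \<phi> carr] by blast
  have "P - Q = 0"
  proof (rule ev_eq_0D)
    show "P - Q \<in> carrier (coord_ring N)"
      using P Q by (simp add: induced_bracket_def)
    fix v :: "gen \<Rightarrow> complex" assume "\<And>x. v x \<noteq> 0"
    then obtain pt where pt: "pt \<in> points N" "\<forall>x\<in>gens N. central_char m \<epsilon> pt x = v x"
      using central_char_surj[OF assms(1)] by meson
    have "ev N (central_char m \<epsilon> pt) P = ev N (central_char m \<epsilon> pt) Q"
      using induced_bracket_ev[OF assms(2,3) P _ a(1) pt(1)] lim
        induced_bracket_ev[OF assms(2,3) Q _ a(1) pt(1)] a(2) by simp
    moreover have "ev N (central_char m \<epsilon> pt) R = ev N v R" for R
      using pt(2) by (intro ev_cong) auto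
    ultimately show "ev N v (P - Q) = 0" by (simp add: ev_diff)
  qed
  then show ?thesis by simp
qed

section \<open>The limits of the commutators\<close>

text \<open>The elements \<open>W j\<close> do not depend on q, so the union of their supports is
  the finite set of words required by \<open>F_tendsto\<close>.\<close>

lemma F_tendstoI:
  fixes n :: nat
  assumes W: "\<And>j. j \<le> n \<Longrightarrow> W j \<in> carrier (free_alg N)"
    and c: "\<And>j. j \<le> n \<Longrightarrow> ((\<lambda>q. c q j) \<longlongrightarrow> d j) (at \<epsilon>)"
    and f: "\<forall>\<^sub>F q in at \<epsilon>. f q = F_proj N q (\<Sum>j\<le>n. free_const (c q j) * W j)"
  shows "F_tendsto N \<epsilon> f (F_proj N \<epsilon> (\<Sum>j\<le>n. free_const (d j) * W j))"
proof -
  let ?S = "\<Union>j\<le>n. Poly_Mapping.keys (W j)"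
  have lookup: "Poly_Mapping.lookup (\<Sum>j\<le>n. free_const (a j) * W j) w
      = (\<Sum>j\<le>n. a j * Poly_Mapping.lookup (W j) w)" for a w
    by (simp add: lookup_sum)
  have keys: "Poly_Mapping.keys (\<Sum>j\<le>n. free_const (a j) * W j) \<subseteq> ?S" for a
  proof
    fix w assume "w \<in> Poly_Mapping.keys (\<Sum>j\<le>n. free_const (a j) * W j)"
    then have "(\<Sum>j\<le>n. a j * Poly_Mapping.lookup (W j) w) \<noteq> 0"
      by (simp add: in_keys_iff lookup)
    then obtain j where "j \<le> n" "a j * Poly_Mapping.lookup (W j) w \<noteq> 0"
      by (meson atMost_iff sum.neutral)
    then show "w \<in> ?S" by (auto simp: in_keys_iff)
  qed
  have carr: "(\<Sum>j\<le>n. free_const (a j) * W j) \<in> carrier (free_alg N)" for a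
    using W by (intro free_carrier_sum free_carrier_mult free_carrier_const) auto
  show ?thesis
    unfolding F_tendsto_def
  proof (intro exI conjI allI)
    show "\<forall>\<^sub>F q in at \<epsilon>. (\<Sum>j\<le>n. free_const (c q j) * W j) \<in> carrier (free_alg N) \<and>
        Poly_Mapping.keys (\<Sum>j\<le>n. free_const (c q j) * W j) \<subseteq> ?S \<and>
        F_proj N q (\<Sum>j\<le>n. free_const (c q j) * W j) = f q"
      using f by eventually_elim (simp add: carr keys)
    show "((\<lambda>q. Poly_Mapping.lookup (\<Sum>j\<le>n. free_const (c q j) * W j) w) \<longlongrightarrow>
        Poly_Mapping.lookup (\<Sum>j\<le>n. free_const (d j) * W j) w) (at \<epsilon>)" for w
      unfolding lookup using c by (intro tendsto_sum tendsto_mult tendsto_const) auto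
  qed (simp_all add: carr)
qed

text \<open>The denominators vanish at \<epsilon> itself, but a punctured neighbourhood of it avoids
  the finitely many bad values.\<close>

lemma eventually_not_root:
  assumes "m > 0" "\<epsilon> \<noteq> 0"
  shows "\<forall>\<^sub>F q in at (\<epsilon>::complex). q \<noteq> 0 \<and> q ^ m \<noteq> 1"
proof -
  have fin: "finite (insert 0 {q::complex. q ^ m = 1})"
    using finite_nth_roots[OF assms(1), of 1] by simp
  have "\<forall>\<^sub>F q in at \<epsilon>. \<forall>a\<in>insert 0 {q. q ^ m = 1}. q \<noteq> a"
    by (intro eventually_ball_finite[OF fin] ballI eventually_neq_at_within)
  then show ?thesis by eventually_elim auto
qed

lemma induced_bracket_swap:
  assumes "x \<in> gens N" "y \<in> gens N" "induced_bracket N m \<epsilon> x y P"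
  shows "induced_bracket N m \<epsilon> y x (- P)"
proof -
  obtain \<phi> where P: "P \<in> carrier (coord_ring N)" and \<phi>: "coord_correspondence N m \<epsilon> \<phi>"
    and lim: "F_tendsto N \<epsilon> (bracket_quotient N m x y) (\<phi> P)"
    using assms(3) unfolding induced_bracket_def bracket_quotient_def[abs_def] by blast
  from lim obtain r l S where r: "finite S" "l \<in> carrier (free_alg N)" "F_proj N \<epsilon> l = \<phi> P"
    "\<forall>\<^sub>F q in at \<epsilon>. r q \<in> carrier (free_alg N) \<and> Poly_Mapping.keys (r q) \<subseteq> S \<and>
      F_proj N q (r q) = bracket_quotient N m x y q"
    "\<And>w. ((\<lambda>q. Poly_Mapping.lookup (r q) w) \<longlongrightarrow> Poly_Mapping.lookup l w) (at \<epsilon>)"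
    unfolding F_tendsto_def by blast
  \<comment> \<open>Negation is written as multiplication by a constant, since \<phi> is known to
    respect products and constants.\<close>
  have "\<phi> (- P) = \<phi> (coord_const (- 1) * P)"
    by (simp add: coord_const_hom)
  also have "\<dots> = F_proj N \<epsilon> (- l)"
    using ring_hom_mult[of \<phi> "coord_ring N" "F_alg N \<epsilon>" "coord_const (- 1)" P] \<phi> P r(2)
    by (simp add: coord_correspondence_def F_const_def F_proj_mult free_const_hom flip: r(3))
  finally have \<phi>l: "\<phi> (- P) = F_proj N \<epsilon> (- l)" .
  have "F_proj N q (- r q) = bracket_quotient N m y x q"
    if "r q \<in> carrier (free_alg N)" "F_proj N q (r q) = bracket_quotient N m x y q" for q
  proof -
    let ?p = "\<lambda>x y. free_const (1 / (of_nat m * (q ^ m - 1))) *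
      (free_gen x ^ m * free_gen y ^ m - free_gen y ^ m * free_gen x ^ m)"
    have carr: "?p x y \<in> carrier (free_alg N)" "?p y x \<in> carrier (free_alg N)"
      using assms by (auto intro!: free_carrier_mult free_carrier_diff free_carrier_power)
    have "fcong N q (r q) (?p x y)"
      using that carr assms by (simp add: bracket_quotient_eq F_proj_eq_iff)
    then have "fcong N q (- r q) (- ?p x y)" by (rule fcong_uminus)
    also have "- ?p x y = ?p y x" by (simp flip: mult_minus_right)
    finally show ?thesis
      using that carr assms by (simp add: bracket_quotient_eq F_proj_eq_iff)
  qed
  then have ev: "\<forall>\<^sub>F q in at \<epsilon>. - r q \<in> carrier (free_alg N) \<and> Poly_Mapping.keys (- r q) \<subseteq> S \<and>
      F_proj N q (- r q) = bracket_quotient N m y x q"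
    using r(4) by (auto elim!: eventually_mono)
  have "F_tendsto N \<epsilon> (bracket_quotient N m y x) (\<phi> (- P))"
    unfolding F_tendsto_def
    by (rule exI[of _ "\<lambda>q. - r q"], rule exI[of _ "- l"], rule exI[of _ S])
       (use r(1,2,5) ev \<phi>l in \<open>auto intro: tendsto_minus\<close>)
  then show ?thesis
    using P \<phi> by (auto simp: induced_bracket_def bracket_quotient_def[abs_def])
qed

lemma induced_bracket_self:
  assumes "\<epsilon> ^ m = 1" "\<epsilon> \<noteq> 0" "x \<in> gens N"
  shows "induced_bracket N m \<epsilon> x x 0"
proof (rule induced_bracketI[OF assms(1,2)])
  show "F_tendsto N \<epsilon> (bracket_quotient N m x x) (F_proj N \<epsilon> (\<Sum>j\<le>(0::nat). free_const 0 * 0))"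
    by (rule F_tendstoI[where c = "\<lambda>_ _. 0"]) (use assms(3) in \<open>auto simp: bracket_quotient_eq\<close>)
qed simp_all

text \<open>The commutator is (q^(m^2) - 1) y^m x^m. Divided by m(q^m - 1), its coefficient is the
  geometric sum of the q^(mk) for k < m, over m, which tends to 1. Relations with constant q^(-1)
  are read in the opposite order, whence their minus sign.\<close>

lemma induced_bracket_qcom:
  assumes m: "m > 0" "\<epsilon> ^ m = 1" "\<epsilon> \<noteq> 0" and x: "x \<in> gens N" and y: "y \<in> gens N"
    and xy: "\<And>q. q \<noteq> 0 \<Longrightarrow> qcom N q q (free_gen x) (free_gen y)"
  shows "induced_bracket N m \<epsilon> x y (coord x * coord y)"
proof (rule induced_bracketI[OF m(2,3)])
  let ?X = "free_gen x ^ m" and ?Y = "free_gen y ^ m"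
  have XY [simp]: "?X \<in> carrier (free_alg N)" "?Y \<in> carrier (free_alg N)"
    using x y by auto
  have fq: "bracket_quotient N m x y q =
      F_proj N q (\<Sum>j\<le>(0::nat). free_const ((\<Sum>k<m. (q ^ m) ^ k) / of_nat m) * (?Y * ?X))"
    if q: "q \<noteq> 0" "q ^ m \<noteq> 1" for q
  proof -
    have "fcong N q (?X * ?Y) (free_const (q ^ (m * m)) * (?Y * ?X))"
      using qcom_power[OF xy[OF q(1)], of m m] by (simp add: qcom_def)
    then have "fcong N q (?X * ?Y - ?Y * ?X) (free_const (q ^ (m * m)) * (?Y * ?X) - ?Y * ?X)"
      by (intro fcong_diff) auto
    also have "free_const (q ^ (m * m)) * (?Y * ?X) - ?Y * ?X = free_const (q ^ (m * m) - 1) * (?Y * ?X)"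
      by (simp add: free_const_hom left_diff_distrib)
    finally have "fcong N q (free_const (1 / (of_nat m * (q ^ m - 1))) * (?X * ?Y - ?Y * ?X))
        (free_const (1 / (of_nat m * (q ^ m - 1))) * (free_const (q ^ (m * m) - 1) * (?Y * ?X)))"
      by (rule fcong_const_cancel)
    also have "\<dots> = free_const ((\<Sum>k<m. (q ^ m) ^ k) / of_nat m) * (?Y * ?X)"
      using q power_diff_1_eq[of "q ^ m" m]
      by (simp only: free_const_mult_assoc) (simp add: power_mult)
    finally show ?thesis
      using x y by (simp add: bracket_quotient_eq F_proj_eq_iff fcong_carrier)
  qed
  have "((\<lambda>q. (\<Sum>k<m. (q ^ m) ^ k) / of_nat m) \<longlongrightarrow> (\<Sum>k<m. (\<epsilon> ^ m) ^ k) / of_nat m) (at \<epsilon>)"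
    by (intro tendsto_intros) (use m in auto)
  then have "((\<lambda>q. (\<Sum>k<m. (q ^ m) ^ k) / of_nat m) \<longlongrightarrow> 1) (at \<epsilon>)"
    using m by simp
  then show "F_tendsto N \<epsilon> (bracket_quotient N m x y)
      (F_proj N \<epsilon> (\<Sum>j\<le>(0::nat). free_const 1 * (?Y * ?X)))"
    by (intro F_tendstoI[where c = "\<lambda>q j. (\<Sum>k<m. (q ^ m) ^ k) / of_nat m"])
       (use eventually_not_root[OF m(1,3)] fq in \<open>auto elim!: eventually_mono\<close>)
  have "fcong N \<epsilon> (power_subst N m (coord x * coord y)) (?Y * ?X)"
    using fcong_trans[OF power_subst_mult[OF m(2,3)]] qcom_gen_powers[OF m(2,3) x y] x y
    by (simp add: power_subst_coord qcom_commute_iff)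
  then show "fcong N \<epsilon> (\<Sum>j\<le>(0::nat). free_const 1 * (?Y * ?X)) (power_subst N m (coord x * coord y))"
    by (simp add: free_const_hom fcong_sym)
qed (use x y in simp)

lemma induced_bracket_z_z:
  assumes "m > 0" "\<epsilon> ^ m = 1" "\<epsilon> \<noteq> 0" "i < j" "j < N"
  shows "induced_bracket N m \<epsilon> (Z i) (Z j) (- (coord_a i * coord_a j))"
proof -
  have "qcom N q q (fz j) (fz i)" if "q \<noteq> 0" for q
    using qcom_sym[OF qcom_z_z] assms that by fastforce
  then have "induced_bracket N m \<epsilon> (Z j) (Z i) (coord_a j * coord_a i)"
    using assms by (intro induced_bracket_qcom) auto
  from induced_bracket_swap[OF _ _ this] show ?thesis
    using assms by (simp add: mult.commute)
qed

lemma induced_bracket_zs_zs: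
  assumes "m > 0" "\<epsilon> ^ m = 1" "\<epsilon> \<noteq> 0" "i < j" "j < N"
  shows "induced_bracket N m \<epsilon> (Zs i) (Zs j) (coord_as i * coord_as j)"
  using assms by (intro induced_bracket_qcom qcom_zs_zs) auto

lemma induced_bracket_z_zs:
  assumes "m > 0" "\<epsilon> ^ m = 1" "\<epsilon> \<noteq> 0" "i < N" "j < N" "i \<noteq> j"
  shows "induced_bracket N m \<epsilon> (Z i) (Zs j) (- (coord_a i * coord_as j))"
proof -
  have "induced_bracket N m \<epsilon> (Zs j) (Z i) (coord_as j * coord_a i)"
    using assms by (intro induced_bracket_qcom qcom_zs_z) auto
  from induced_bracket_swap[OF _ _ this] show ?thesis
    using assms by (simp add: mult.commute)
qed

section \<open>The commutator of the m-th powers of z_i and its adjoint partner\<close>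

lemma prod_diff_telescope:
  fixes a b :: "nat \<Rightarrow> 'a::comm_ring_1"
  shows "(\<Prod>k<n. a k) - (\<Prod>k<n. b k) = (\<Sum>k<n. (\<Prod>l<k. b l) * (a k - b k) * (\<Prod>l=Suc k..<n. a l))"
proof (induction n)
  case (Suc n)
  have "(\<Sum>k<n. (\<Prod>l<k. b l) * (a k - b k) * (\<Prod>l=Suc k..<Suc n. a l))
      = (\<Sum>k<n. (\<Prod>l<k. b l) * (a k - b k) * (\<Prod>l=Suc k..<n. a l)) * a n"
    unfolding sum_distrib_right by (rule sum.cong) (simp_all add: mult.assoc)
  also have "\<dots> = ((\<Prod>k<n. a k) - (\<Prod>k<n. b k)) * a n" by (simp add: Suc)
  finally show ?case by (simp add: algebra_simps)
qed simp

text \<open>\<open>quotient_poly m q\<close> is the quotient of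
  $\prod_{k<m}(1-q^{-2k}X) - \prod_{k=1}^{m}(1-q^{2k}X)$ by $m(q^m-1)$: since
  $q^{-2(m-k)}-q^{2k} = q^{2k-2m}(1-q^{2m})$, the telescoped difference of products is
  visibly divisible, with a quotient continuous in $q$ also at the roots of unity.\<close>

definition quotient_poly :: "nat \<Rightarrow> complex \<Rightarrow> complex poly" where
  "quotient_poly m q = (\<Sum>k<m. (\<Prod>l<k. [:1, - ((q^2) ^ Suc l):])
     * [:0, (q^2) ^ Suc k * (q ^ m + 1) / (of_nat m * (q ^ m)^2):]
     * (\<Prod>l=Suc k..<m. [:1, - ((q^2) ^ Suc l / (q ^ m)^2):]))"

lemma smult_sum_right: "smult c (sum f K) = (\<Sum>k\<in>K. smult c (f k))"
  by (induction K rule: infinite_finite_induct) (simp_all add: smult_add_right)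

lemma smult_quotient_poly:
  assumes "m > 0" "q \<noteq> 0"
  shows "smult (of_nat m * (q ^ m - 1)) (quotient_poly m q)
    = (\<Prod>k<m. [:1, - (inverse (q^2) ^ k):]) - (\<Prod>k<m. [:1, - ((q^2) ^ Suc k):])"
proof -
  let ?b = "\<lambda>k. [:1, - ((q^2) ^ Suc k):]" and ?a = "\<lambda>k. [:1, - ((q^2) ^ Suc k / (q ^ m)^2):]"
  \<comment> \<open>With k counted from the other end, the exponents of the first product become
    those of the second, up to the common factor q^(-2m).\<close>
  have "inverse (q^2) ^ (m - Suc k) = (q^2) ^ Suc k / (q ^ m)^2" if "k < m" for k
  proof -
    have "(q ^ m)^2 = (q^2) ^ Suc k * (q^2) ^ (m - Suc k)"
    proof -
      have "(q ^ m)^2 = (q^2) ^ (Suc k + (m - Suc k))"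
        using that by (simp only: le_add_diff_inverse Suc_le_eq) (simp flip: power_mult add: mult.commute)
      then show ?thesis by (simp only: power_add)
    qed
    then show ?thesis using assms by (simp add: power_inverse field_simps)
  qed
  then have "(\<Prod>k<m. [:1, - (inverse (q^2) ^ (m - Suc k)):]) = (\<Prod>k<m. ?a k)"
    by (intro prod.cong) auto
  then have a: "(\<Prod>k<m. [:1, - (inverse (q^2) ^ k):]) = (\<Prod>k<m. ?a k)"
    using prod.nat_diff_reindex[of "\<lambda>k. [:1, - (inverse (q^2) ^ k):]" m] by simp
  \<comment> \<open>With Q = q^m one has 1 - Q^(-2) = (Q - 1)(Q + 1) / Q^2. The factor Q - 1 cancels
    the denominator of the bracket, and Q + 1, which tends to 2, is the origin of the constant
    2.\<close>
  have "?a k - ?b k = smult (of_nat m * (q ^ m - 1))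
      [:0, (q^2) ^ Suc k * (q ^ m + 1) / (of_nat m * (q ^ m)^2):]" for k
    using assms by (simp add: field_simps power2_eq_square)
  then show ?thesis
    unfolding a prod_diff_telescope quotient_poly_def
    by (simp only: smult_sum_right mult_smult_left mult_smult_right)
qed

text \<open>The derivative of 1 - sX is -s, so 2sX/c is -2/c times X times this derivative: the
  shape of a summand in the product rule.\<close>

lemma mult_linear_pderiv:
  fixes P Q :: "complex poly"
  shows "P * [:0, s * 2 / c:] * Q = smult (- 2 / c) (pCons 0 (P * Q * pderiv [:1, - s:]))"
  by (simp add: pderiv_pCons mult.commute)

text \<open>At \<epsilon> the factors of the two products coincide, so each telescoping summand is
  the full product with one factor replaced by a multiple of X, and the sum is the product
  rule.\<close>

lemma quotient_poly_root:
  assumes "m > 0" "\<epsilon> ^ m = 1"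
  shows "quotient_poly m \<epsilon> = smult (- 2 / of_nat m) (pCons 0 (pderiv (\<Prod>k<m. [:1, - ((\<epsilon>^2) ^ Suc k):])))"
proof -
  let ?b = "\<lambda>k. [:1, - ((\<epsilon>^2) ^ Suc k):]"
  have "(\<Prod>l<k. ?b l) * [:0, (\<epsilon>^2) ^ Suc k * 2 / of_nat m:] * (\<Prod>l=Suc k..<m. ?b l)
      = smult (- 2 / of_nat m) (pCons 0 ((\<Prod>l\<in>{..<m} - {k}. ?b l) * pderiv (?b k)))" if "k < m" for k
  proof -
    have "{..<m} - {k} = {..<k} \<union> {Suc k..<m}" using that by auto
    moreover have "{..<k} \<inter> {Suc k..<m} = {}" by auto
    ultimately have "(\<Prod>l\<in>{..<m} - {k}. ?b l) = (\<Prod>l<k. ?b l) * (\<Prod>l=Suc k..<m. ?b l)"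
      using prod.union_disjoint[of "{..<k}" "{Suc k..<m}" ?b] by (metis finite_lessThan finite_atLeastLessThan)
    then show ?thesis
      using mult_linear_pderiv[of "\<Prod>l<k. ?b l" "(\<epsilon>^2) ^ Suc k" "of_nat m" "\<Prod>l=Suc k..<m. ?b l"]
      by metis
  qed
  then have "quotient_poly m \<epsilon>
      = (\<Sum>k<m. smult (- 2 / of_nat m) (pCons 0 ((\<Prod>l\<in>{..<m} - {k}. ?b l) * pderiv (?b k))))"
    unfolding quotient_poly_def using assms(2) by (intro sum.cong refl) (simp only: lessThan_iff one_add_one power_one div_by_1 mult_1_right)
  also have "\<dots> = smult (- 2 / of_nat m) (pCons 0 (\<Sum>k<m. (\<Prod>l\<in>{..<m} - {k}. ?b l) * pderiv (?b k)))"
  proof -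
    have "(\<Sum>k\<in>K. pCons 0 (g k)) = pCons 0 (\<Sum>k\<in>K. g k)" for K and g :: "nat \<Rightarrow> complex poly"
      by (induction K rule: infinite_finite_induct) simp_all
    then show ?thesis by (simp only: smult_sum_right[symmetric])
  qed
  finally show ?thesis by (simp only: pderiv_prod)
qed

lemma isCont_coeff_mult:
  fixes P Q :: "complex \<Rightarrow> complex poly"
  assumes "\<And>j. isCont (\<lambda>q. coeff (P q) j) \<epsilon>" "\<And>j. isCont (\<lambda>q. coeff (Q q) j) \<epsilon>"
  shows "isCont (\<lambda>q. coeff (P q * Q q) j) \<epsilon>"
  unfolding coeff_mult using assms by (intro continuous_intros)

lemma isCont_coeff_prod:
  fixes P :: "'a \<Rightarrow> complex \<Rightarrow> complex poly"
  assumes "\<And>k j. isCont (\<lambda>q. coeff (P k q) j) \<epsilon>"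
  shows "isCont (\<lambda>q. coeff (\<Prod>k\<in>K. P k q) j) \<epsilon>"
proof (induction K arbitrary: j rule: infinite_finite_induct)
  case (insert k K)
  then show ?case using assms by (simp add: isCont_coeff_mult)
qed simp_all

lemma isCont_coeff_linear:
  assumes "isCont a \<epsilon>" "isCont b \<epsilon>"
  shows "isCont (\<lambda>q. coeff [:a q, b q:] j) (\<epsilon>::complex)"
proof (cases j)
  case (Suc k)
  then show ?thesis using assms by (cases k) simp_all
qed (use assms in simp)

lemma isCont_coeff_quotient_poly:
  assumes "m > 0" "\<epsilon> \<noteq> 0"
  shows "isCont (\<lambda>q. coeff (quotient_poly m q) j) \<epsilon>"
  unfolding quotient_poly_def coeff_sum
  using assms
  by (intro continuous_intros isCont_coeff_mult isCont_coeff_prod isCont_coeff_linear) auto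

text \<open>Serves odd and even m alike; parity decides only whether this limit can be written in
  the m-th powers.\<close>

lemma F_tendsto_z_zs:
  assumes m: "m > 0" "\<epsilon> ^ m = 1" "\<epsilon> \<noteq> 0" and i: "i < N"
  shows "F_tendsto N \<epsilon> (bracket_quotient N m (Z i) (Zs i))
    (F_proj N \<epsilon> (homog m (head_sum N i) (tail_sum N i) (quotient_poly m \<epsilon>)))"
  unfolding homog_def
proof (rule F_tendstoI)
  let ?H = "homog m (head_sum N i) (tail_sum N i)"
  show "((\<lambda>q. coeff (quotient_poly m q) j) \<longlongrightarrow> coeff (quotient_poly m \<epsilon>) j) (at \<epsilon>)" for j
    using isCont_coeff_quotient_poly[OF m(1,3)] by (simp add: isCont_def)
  have "bracket_quotient N m (Z i) (Zs i) q = F_proj N q (?H (quotient_poly m q))"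
    if q: "q \<noteq> 0" "q ^ m \<noteq> 1" for q
  proof -
    have "fcong N q (fz i ^ m * fzs i ^ m - fzs i ^ m * fz i ^ m)
        (?H (smult (of_nat m * (q ^ m - 1)) (quotient_poly m q)))"
      unfolding smult_quotient_poly[OF m(1) q(1)] homog_diff
      by (intro fcong_diff fcong_z_power_zs_power fcong_zs_power_z_power q i)
    then have "fcong N q (free_const (1 / (of_nat m * (q ^ m - 1))) *
          (fz i ^ m * fzs i ^ m - fzs i ^ m * fz i ^ m))
        (free_const (1 / (of_nat m * (q ^ m - 1))) *
          ?H (smult (of_nat m * (q ^ m - 1)) (quotient_poly m q)))"
      by (rule fcong_const_cancel)
    also have "\<dots> = ?H (quotient_poly m q)"
      using m q by (simp flip: homog_smult)
    finally show ?thesis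
      using i by (simp add: bracket_quotient_eq F_proj_eq_iff fcong_carrier)
  qed
  then show "\<forall>\<^sub>F q in at \<epsilon>. bracket_quotient N m (Z i) (Zs i) q =
      F_proj N q (\<Sum>j\<le>m. free_const (coeff (quotient_poly m q) j) *
        (head_sum N i ^ (m - j) * tail_sum N i ^ j))"
    using eventually_not_root[OF m(1,3)] unfolding homog_def by (auto elim!: eventually_mono)
qed (use i in auto)

section \<open>Products over roots of unity of odd and even order\<close>

lemma primitive_root_power_eq_1_iff:
  assumes "primitive_root_of_unity m \<epsilon>"
  shows "\<epsilon> ^ k = 1 \<longleftrightarrow> m dvd k"
proof -
  have m: "m > 0" "\<epsilon> ^ m = 1" using primitive_rootD[OF assms] by auto
  have "\<epsilon> ^ k = \<epsilon> ^ (m * (k div m) + k mod m)" by simp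
  also have "\<dots> = \<epsilon> ^ (k mod m)" using m by (simp only: power_add power_mult) simp
  finally have "\<epsilon> ^ k = \<epsilon> ^ (k mod m)" .
  moreover have "\<epsilon> ^ (k mod m) = 1 \<longleftrightarrow> k mod m = 0"
    using assms m by (metis gr0I mod_less_divisor power_0 primitive_root_of_unity_def)
  ultimately show ?thesis by (simp add: mod_eq_0_iff_dvd)
qed

text \<open>Both sides have degree at most n and agree at n + 1 points: at 0 and at the n powers of
  \<omega>.\<close>

lemma prod_linear_primitive:
  assumes "primitive_root_of_unity n \<omega>"
  shows "(\<Prod>k<n. [:1, - (\<omega> ^ Suc k):]) = 1 - monom 1 n"
proof -
  have n: "n > 0" "\<omega> ^ n = 1" "\<omega> \<noteq> 0" using primitive_rootD[OF assms] by auto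
  let ?D = "(\<Prod>k<n. [:1, - (\<omega> ^ Suc k):]) - (1 - monom 1 n)"
  have deg: "degree ?D \<le> n"
  proof (intro degree_diff_le)
    show "degree (\<Prod>k<n. [:1, - (\<omega> ^ Suc k):]) \<le> n" by (rule degree_prod_linear)
    show "degree (1 :: complex poly) \<le> n" by simp
    show "degree (monom (1::complex) n) \<le> n" by (rule degree_monom_le)
  qed
  have "inj_on (\<lambda>k. \<omega> ^ k) {..<n}"
  proof (rule linorder_inj_onI)
    fix a b assume ab: "a < b" "a \<in> {..<n}" "b \<in> {..<n}"
    show "\<omega> ^ a \<noteq> \<omega> ^ b"
    proof
      assume "\<omega> ^ a = \<omega> ^ b"
      then have "\<omega> ^ (b - a) = 1"
        using ab(1) n(3) by (simp add: power_diff)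
      then have "n dvd b - a"
        using primitive_root_power_eq_1_iff[OF assms] by blast
      with ab show False by (auto dest: dvd_imp_le)
    qed
  qed auto
  then have "card (insert 0 ((\<lambda>k. \<omega> ^ k) ` {..<n})) = Suc n"
    using n(3) by (subst card_insert_disjoint) (auto simp: card_image)
  moreover have "insert 0 ((\<lambda>k. \<omega> ^ k) ` {..<n}) \<subseteq> {x. poly ?D x = 0}"
  proof -
    have "(\<Prod>k<n. 1 - \<omega> ^ j * \<omega> ^ Suc k) = 0" if "j < n" for j
    proof (rule prod_zero)
      show "\<exists>k\<in>{..<n}. 1 - \<omega> ^ j * \<omega> ^ Suc k = 0"
        \<comment> \<open>For this k the exponent \<open>Suc k\<close> is n - j, so the power of
          \<omega> is \<omega>^n = 1 and the factor vanishes.\<close>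
        using that n by (intro bexI[of _ "n - Suc j"]) (auto simp flip: power_add power_Suc)
    qed simp
    moreover have "(\<omega> ^ j) ^ n = 1" for j
      using n(2) by (metis mult.commute power_mult power_one)
    ultimately show ?thesis using n by (auto simp: poly_prod poly_monom)
  qed
  ultimately have "Suc n \<le> card {x. poly ?D x = 0}" if "?D \<noteq> 0"
    using card_mono[OF poly_roots_finite[OF that]] by metis
  then have "?D = 0"
    using card_poly_roots_bound[of ?D] deg by force
  then show ?thesis by simp
qed

lemma primitive_root_square_odd:
  assumes "primitive_root_of_unity m \<epsilon>" "odd m"
  shows "primitive_root_of_unity m (\<epsilon>^2)"
proof -
  have m: "m > 0" "\<epsilon> ^ m = 1" using primitive_rootD[OF assms(1)] by auto
  show ?thesis
    unfolding primitive_root_of_unity_def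
  proof (intro conjI allI impI m(1))
    show "(\<epsilon>\<^sup>2) ^ m = 1" using m(2) by (metis power_mult mult.commute power_one)
    fix k assume k: "0 < k \<and> k < m"
    have "\<not> m dvd 2 * k"
      using k assms(2) by (metis coprime_dvd_mult_right_iff coprime_right_2_iff_odd dvd_imp_le leD)
    then show "(\<epsilon>\<^sup>2) ^ k \<noteq> 1"
      using primitive_root_power_eq_1_iff[OF assms(1), of "2 * k"] by (simp add: power_mult)
  qed
qed

lemma quotient_poly_odd:
  assumes "primitive_root_of_unity m \<epsilon>" "odd m"
  shows "quotient_poly m \<epsilon> = monom 2 m"
proof -
  have m: "m > 0" "\<epsilon> ^ m = 1" using primitive_rootD[OF assms(1)] by auto
  from prod_linear_primitive[OF primitive_root_square_odd[OF assms]]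
  have "quotient_poly m \<epsilon> = smult (- 2 / of_nat m) (pCons 0 (pderiv (1 - monom 1 m)))"
    using m by (simp only: quotient_poly_root prod_linear_primitive)
  also have "\<dots> = monom 2 m"
  proof (rule poly_eqI)
    fix j
    have "pderiv (1 - monom 1 m) = - monom (of_nat m :: complex) (m - 1)"
      by (simp add: pderiv_diff pderiv_monom)
    then show "coeff (smult (- 2 / of_nat m) (pCons 0 (pderiv (1 - monom 1 m)))) j
        = coeff (monom (2::complex) m) j"
      using m(1) by (cases j) auto
  qed
  finally show ?thesis .
qed

text \<open>Now \<epsilon>^2 is a primitive n-th root of unity, and the 2n factors run through its
  powers twice.\<close>

lemma prod_linear_even:
  assumes "primitive_root_of_unity (2 * n) \<epsilon>"
  shows "(\<Prod>k<2 * n. [:1, - ((\<epsilon>^2) ^ Suc k):]) = (1 - monom 1 n) * (1 - monom 1 n)"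
proof -
  have m: "n > 0" "\<epsilon> ^ (2 * n) = 1" using primitive_rootD[OF assms(1)] by auto
  have prim: "primitive_root_of_unity n (\<epsilon>^2)"
    unfolding primitive_root_of_unity_def
  proof (intro conjI allI impI m(1))
    show pow: "(\<epsilon>\<^sup>2) ^ n = 1" using m(2) by (simp add: power_mult)
    fix k assume k: "0 < k \<and> k < n"
    then have "\<not> 2 * n dvd 2 * k" by (auto dest: dvd_imp_le)
    then show "(\<epsilon>\<^sup>2) ^ k \<noteq> 1"
      using primitive_root_power_eq_1_iff[OF assms(1), of "2 * k"] by (simp add: power_mult)
  qed
  let ?b = "\<lambda>k. [:1, - ((\<epsilon>^2) ^ Suc k):]"
  have "(\<Prod>k<n + l. b k) = (\<Prod>k<n. b k) * (\<Prod>k<l. b (n + k))" for b :: "nat \<Rightarrow> complex poly" and l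
    by (induction l) (simp_all add: mult.assoc)
  from this[of ?b n] have "(\<Prod>k<2 * n. ?b k) = (\<Prod>k<n. ?b k) * (\<Prod>k<n. ?b (n + k))"
    by (simp add: mult_2)
  also have "(\<Prod>k<n. ?b (n + k)) = (\<Prod>k<n. ?b k)"
    using primitive_rootD(2)[OF prim] by (simp add: power_add)
  finally show ?thesis
    by (simp only: prod_linear_primitive[OF prim])
qed

text \<open>-(1/n) X times the derivative of (1 - X^n)^2 is 2 X^n (1 - X^n), which homogenises to 2
  (C^n - A^n) A^n.\<close>

lemma quotient_poly_even:
  assumes "primitive_root_of_unity (2 * n) \<epsilon>"
  shows "quotient_poly (2 * n) \<epsilon> = monom 2 n - monom 2 (2 * n)"
proof -
  have m: "n > 0" "\<epsilon> ^ (2 * n) = 1" using primitive_rootD[OF assms(1)] by auto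
  with prod_linear_even[OF assms] have "quotient_poly (2 * n) \<epsilon> = smult (- 2 / of_nat (2 * n))
      (pCons 0 (pderiv ((1 - monom 1 n) * (1 - monom 1 n))))"
    using m by (simp only: quotient_poly_root mult_pos_pos pos2)
  also have "\<dots> = monom 2 n - monom 2 (2 * n)"
  proof (rule poly_eqI)
    fix j
    have "pderiv ((1 - monom 1 n) * (1 - monom 1 n))
        = - (2 * ((1 - monom 1 n) * monom (of_nat n :: complex) (n - 1)))"
      unfolding pderiv_mult by (simp add: pderiv_diff pderiv_monom flip: mult_2)
    also have "\<dots> = smult (- 2) (monom (of_nat n) (n - 1) - monom (of_nat n) (2 * n - 1))"
      using m(1) by (simp add: left_diff_distrib mult_monom numeral_poly mult_2)
    finally show "coeff (smult (- 2 / of_nat (2 * n)) (pCons 0 (pderiv ((1 - monom 1 n) * (1 - monom 1 n))))) j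
        = coeff (monom (2::complex) n - monom 2 (2 * n)) j"
      using m(1) by (cases j) auto
  qed
  finally show ?thesis .
qed

text \<open>For odd m one has z_k^m zs_k^m = C_k^m - A_k^m with C_k and A_k the sums over j >= k and
  j > k. Since A_k = C_(k+1), these differences telescope, ending in the m-th power of an empty
  sum.\<close>

lemma fcong_tail_sum_power:
  assumes prim: "primitive_root_of_unity m \<epsilon>" and "odd m" and i: "i < N"
  shows "fcong N \<epsilon> (\<Sum>k\<in>{i<..<N}. fz k ^ m * fzs k ^ m) (tail_sum N i ^ m)"
proof -
  have m: "m > 0" "\<epsilon> ^ m = 1" "\<epsilon> \<noteq> 0" using primitive_rootD[OF prim] by auto
  have root2: "(\<epsilon>\<^sup>2) ^ m = 1" using m(2) by (metis power_mult mult.commute power_one)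
  define f where "f k = (\<Sum>j\<in>{k..<N}. fz j * fzs j) ^ m" for k
  have tail: "tail_sum N k ^ m = f (Suc k)" for k
    by (simp add: tail_sum_def f_def atLeastSucLessThan_greaterThanLessThan)
  have "fcong N \<epsilon> (fz k ^ m * fzs k ^ m) (f k - f (Suc k))" if "k < N" for k
  proof -
    have "(\<Prod>k<m. [:1, - (inverse (\<epsilon>^2) ^ k):]) = 1 - monom 1 m"
      unfolding prod_linear_reindex[OF root2]
      using prod_linear_primitive[OF primitive_root_square_odd[OF prim assms(2)]] .
    then have "fcong N \<epsilon> (fz k ^ m * fzs k ^ m)
        (homog m (head_sum N k) (tail_sum N k) (monom 1 0 - monom 1 m))"
      using fcong_z_power_zs_power[OF m(3) that, of m] by simp
    also have "homog m (head_sum N k) (tail_sum N k) (monom 1 0 - monom 1 m)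
        = head_sum N k ^ m - tail_sum N k ^ m"
      by (simp only: homog_diff homog_monom order_refl le0) (simp add: free_const_hom)
    also have "head_sum N k ^ m = f k"
      using that by (simp add: head_sum_def tail_sum_def f_def sum.atLeast_Suc_lessThan
          atLeastSucLessThan_greaterThanLessThan)
    finally show ?thesis by (simp add: tail)
  qed
  then have "fcong N \<epsilon> (\<Sum>k\<in>{i<..<N}. fz k ^ m * fzs k ^ m) (\<Sum>k\<in>{i<..<N}. f k - f (Suc k))"
    by (intro fcong_sum) auto
  also have "(\<Sum>k\<in>{i<..<N}. f k - f (Suc k)) = - (\<Sum>k=Suc i..<N. f (Suc k) - f k)"
    by (simp add: atLeastSucLessThan_greaterThanLessThan flip: sum_negf)
  also have "\<dots> = f (Suc i) - f N"
    using i by (subst sum_Suc_diff') auto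
  also have "f N = 0" using m(1) by (simp add: f_def zero_power)
  finally show ?thesis by (simp add: tail)
qed

definition tail_coord :: "nat \<Rightarrow> nat \<Rightarrow> coord_poly" where
  "tail_coord N i = (\<Sum>k\<in>{i<..<N}. coord_a k * coord_as k)"

lemma tail_coord_carrier [simp]: "tail_coord N i \<in> carrier (coord_ring N)"
  unfolding tail_coord_def by (intro coord_carrier_sum coord_carrier_mult coord_carrier_coord) auto

lemma induced_bracket_z_zs_same:
  assumes prim: "primitive_root_of_unity m \<epsilon>" and "odd m \<or> N \<le> 1" and i: "i < N"
  shows "induced_bracket N m \<epsilon> (Z i) (Zs i) (2 * tail_coord N i)"
proof -
  have m: "m > 0" "\<epsilon> ^ m = 1" "\<epsilon> \<noteq> 0" using primitive_rootD[OF prim] by auto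
  let ?H = "homog m (head_sum N i) (tail_sum N i) (quotient_poly m \<epsilon>)"
  have "fcong N \<epsilon> ?H (power_subst N m (2 * tail_coord N i))"
  proof (cases "odd m")
    case True
    have pair: "fcong N \<epsilon> (power_subst N m (coord_a k * coord_as k)) (fz k ^ m * fzs k ^ m)"
      if "k < N" for k
      using that power_subst_mult[OF m(2,3), of N "coord_a k" "coord_as k"]
      by (simp add: power_subst_coord)
    have "fcong N \<epsilon> (power_subst N m (coord_const 2 * tail_coord N i))
        (free_const 2 * power_subst N m (tail_coord N i))"
      using power_subst_mult[OF m(2,3), of N "coord_const 2" "tail_coord N i"]
      by (simp only: power_subst_const)
    also have "fcong N \<epsilon> (free_const 2 * power_subst N m (tail_coord N i))
        (free_const 2 * (\<Sum>k\<in>{i<..<N}. fz k ^ m * fzs k ^ m))"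
      unfolding tail_coord_def power_subst_sum
      by (intro fcong_const_cancel fcong_sum pair) simp
    also have "fcong N \<epsilon> \<dots> (free_const 2 * tail_sum N i ^ m)"
      by (intro fcong_const_cancel fcong_tail_sum_power prim True i)
    also have "free_const 2 * tail_sum N i ^ m = ?H"
      using prim True by (simp add: quotient_poly_odd homog_monom)
    finally show ?thesis
      by (simp add: coord_const_hom fcong_sym)
  next
    case False
    with assms have "N = 1" "i = 0" by auto
    then have "{i<..<N} = {}" by auto
    then have tail: "tail_sum N i = 0" "tail_coord N i = 0" by (simp_all add: tail_sum_def tail_coord_def)
    \<comment> \<open>For j = 0 the coefficient is 0, because \<open>quotient_poly_root\<close>
      exhibits a multiple of X; for j > 0 the power of the tail sum is 0.\<close>
    have "free_const (coeff (quotient_poly m \<epsilon>) j) * (head_sum N i ^ (m - j) * tail_sum N i ^ j) = 0" for j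
      using m by (cases j) (simp_all add: quotient_poly_root tail free_const_hom)
    then have "?H = 0" by (simp add: homog_def)
    then show ?thesis by (simp add: tail)
  qed
  then show ?thesis
    by (intro induced_bracketI[OF m(2,3) _ F_tendsto_z_zs[OF m i]]) simp_all
qed

lemma prod_homogeneous:
  fixes a :: "nat \<Rightarrow> complex"
  assumes "c \<noteq> 0"
  shows "(\<Prod>k<n. c - a k) = c ^ n * poly (\<Prod>k<n. [:1, - a k:]) (inverse c)"
proof -
  have "(\<Prod>k<n. c - a k) = (\<Prod>k<n. c * (1 - inverse c * a k))"
    using assms by (intro prod.cong) (simp_all add: field_simps)
  then show ?thesis by (simp add: prod.distrib poly_prod)
qed

text \<open>For $m = 2n$ and $i = N-2$ the limit is $2(C^n-A^n)A^n$ with $C = z_iz_i^*+A$ and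
  $A = z_{i+1}z_{i+1}^*$, while all central elements only see $C$, $A$ through $(C^n-A^n)^2$ and
  $A^{2n}$. The points with $A = 1$ and $C^n = 3$, $C^n = -1$ are therefore not distinguished by
  polynomials in the $z_i^m$, $(z_i^*)^m$, but the limit takes the values $4$ and $-4$ there.\<close>

lemma no_induced_bracket_even:
  assumes prim: "primitive_root_of_unity m \<epsilon>" and even: "even m" and N: "N \<ge> 2"
  shows "\<not> induced_bracket N m \<epsilon> (Z (N - 2)) (Zs (N - 2)) P"
proof
  assume P: "induced_bracket N m \<epsilon> (Z (N - 2)) (Zs (N - 2)) P"
  obtain n where mn: "m = 2 * n" using even by blast
  have m: "m > 0" "\<epsilon> ^ m = 1" "\<epsilon> \<noteq> 0" using primitive_rootD[OF prim] by auto
  have n: "n > 0" using m mn by simp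
  have root2: "(\<epsilon>\<^sup>2) ^ m = 1" using m(2) by (metis power_mult mult.commute power_one)
  define i where "i = N - 2"
  have i: "i < N" "Suc i < N" "N = Suc (Suc i)" using N by (auto simp: i_def)
  \<comment> \<open>Constancy of y up to index i makes z_j zs_j act as 0 for j < i, and all zs_j^m
    with j < i have central character 0. So c enters only through zs_i, with C and A acting as c and
    1.\<close>
  define pt :: "complex \<Rightarrow> point"
    where "pt c = ((\<lambda>_. 1), (\<lambda>j. if j \<le> i then c else if j = Suc i then 1 else 0))" for c
  have pt: "pt c \<in> points N" for c by (auto simp: pt_def points_def i(3))
  have val: "ev N (central_char m \<epsilon> (pt c)) P = 2 * c ^ n - 2" for c
  proof -
    have "ev N (central_char m \<epsilon> (pt c)) P
        = rho \<epsilon> (homog m (head_sum N i) (tail_sum N i) (quotient_poly m \<epsilon>)) (\<lambda>_. 1) (pt c)"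
      using P i pt unfolding i_def[symmetric]
      by (intro induced_bracket_ev[OF m(2,3) _ F_tendsto_z_zs[OF m]]) auto
    also have "\<dots> = (\<Sum>j\<le>m. coeff (quotient_poly m \<epsilon>) j * c ^ (m - j))"
      using acts_asD[OF acts_as_homog[OF m(3) i(1)] pt] by (simp add: pt_def)
    also have "\<dots> = (\<Sum>j\<le>2 * n. coeff (monom 2 n) j * c ^ (2 * n - j)) - (\<Sum>j\<le>2 * n. coeff (monom 2 (2 * n)) j * c ^ (2 * n - j))"
      using quotient_poly_even prim by (simp add: mn left_diff_distrib sum_subtractf del: coeff_monom)
    also have "\<dots> = 2 * c ^ n - 2"
      by (simp add: if_distrib[of "\<lambda>x. x * _"] cong: if_cong)
    finally show ?thesis .
  qed
  have char: "central_char m \<epsilon> (pt c) (Zs j) = (if j = Suc i then 1 else if j = i then (c ^ n - 1)^2 else 0)"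
    if "c \<noteq> 0" "j < N" for c j
  proof -
    have "j < Suc (Suc i)" using that(2) i(3) by simp
    then consider "j = Suc i" | "j = i" | "j < i" by linarith
    then show ?thesis
    proof cases
      case 2
      have "(\<Prod>k<m. c - (\<epsilon>^2) ^ Suc k) = c ^ m * (1 - inverse c ^ n)^2"
        using prod_homogeneous[OF that(1), where n = m and a = "\<lambda>k. (\<epsilon>^2) ^ Suc k"] prod_linear_even prim
        by (simp add: mn poly_monom power2_eq_square)
      also have "\<dots> = (c ^ n * (1 - inverse c ^ n))^2"
        by (simp add: mn power_mult_distrib power_mult[symmetric] mult.commute)
      also have "c ^ n * (1 - inverse c ^ n) = c ^ n - 1"
        using that by (simp add: right_diff_distrib power_inverse)
      finally show ?thesis using 2 by (simp add: pt_def)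
    next
      case 3
      have "(\<Prod>k<m. c - (\<epsilon>^2) ^ Suc k * c) = 0"
        using m(1) root2 by (intro prod_zero bexI[of _ "m - 1"]) auto
      with 3 show ?thesis by (simp add: pt_def)
    qed (simp add: pt_def)
  qed
  \<comment> \<open>The values 3 and -1 are symmetric about 1, so (c^n - 1)^2 = (d^n - 1)^2 although
    c^n - 1 and d^n - 1 differ.\<close>
  obtain c d :: complex where "c ^ n = 3" "d ^ n = - 1"
    using nth_root_exists[OF n] by metis
  moreover from this have "c \<noteq> 0" "d \<noteq> 0" using n by (auto simp: zero_power)
  moreover from calculation have "central_char m \<epsilon> (pt c) x = central_char m \<epsilon> (pt d) x" if "x \<in> gens N" for x
    using that by (cases x) (auto simp: char, simp_all add: pt_def)
  then have "ev N (central_char m \<epsilon> (pt c)) P = ev N (central_char m \<epsilon> (pt d)) P"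
    by (intro ev_cong)
  ultimately show False by (simp add: val)
qed

section \<open>The Poisson bracket\<close>

text \<open>The formal partial derivative. Subtraction of exponents truncates at 0, but precisely
  then the coefficient vanishes.\<close>

definition pd :: "gen \<Rightarrow> coord_poly \<Rightarrow> coord_poly" where
  "pd x f = (\<Sum>t\<in>Poly_Mapping.keys f. Poly_Mapping.single (t - Poly_Mapping.single x 1)
     (Poly_Mapping.lookup f t * of_nat (Poly_Mapping.lookup t x)))"

lemma pd_add: "pd x (f + g) = pd x f + pd x g"
  using setsum_keys_plus_distrib[of "\<lambda>t c. Poly_Mapping.single (t - Poly_Mapping.single x 1)
     (c * of_nat (Poly_Mapping.lookup t x))" f g]
  by (simp add: pd_def distrib_right single_add)

lemma pd_single: "pd x (Poly_Mapping.single t c)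
    = Poly_Mapping.single (t - Poly_Mapping.single x 1) (c * of_nat (Poly_Mapping.lookup t x))"
  by (simp add: pd_def)

lemma single_minus_plus:
  fixes s t :: "gen \<Rightarrow>\<^sub>0 nat"
  assumes "Poly_Mapping.lookup t x \<noteq> 0"
  shows "s + (t - Poly_Mapping.single x 1) = s + t - Poly_Mapping.single x 1"
  using assms by (intro poly_mapping_eqI) (auto simp: lookup_add lookup_minus lookup_single when_def)

lemma pd_mult: "pd x (f * g) = f * pd x g + pd x f * g"
proof (induction f rule: poly_mapping_single_induct)
  case (single s c)
  show ?case
  proof (induction g rule: poly_mapping_single_induct)
    case (single t d)
    have 1: "Poly_Mapping.single (s + (t - Poly_Mapping.single x 1)) (c * (d * of_nat (Poly_Mapping.lookup t x)))
        = Poly_Mapping.single (s + t - Poly_Mapping.single x 1) (c * (d * of_nat (Poly_Mapping.lookup t x)))"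
      using single_minus_plus[of t x s] by (cases "Poly_Mapping.lookup t x = 0") auto
    have 2: "Poly_Mapping.single (s - Poly_Mapping.single x 1 + t) (c * of_nat (Poly_Mapping.lookup s x) * d)
        = Poly_Mapping.single (s + t - Poly_Mapping.single x 1) (c * of_nat (Poly_Mapping.lookup s x) * d)"
      using single_minus_plus[of s x t]
      by (cases "Poly_Mapping.lookup s x = 0") (auto simp: add.commute)
    show ?case
      unfolding mult_single pd_single 1 2 single_add[symmetric]
      by (simp add: lookup_add algebra_simps)
  qed (simp add: pd_add algebra_simps)
qed (simp add: pd_add algebra_simps)

lemma pd_const [simp]: "pd x (coord_const c) = 0"
  by (simp add: coord_const_def pd_single)

lemma pd_coord: "pd x (coord y) = (if x = y then 1 else 0)"
  by (auto simp: coord_def pd_single lookup_single)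

lemma pd_carrier [simp]:
  assumes "f \<in> carrier (coord_ring N)"
  shows "pd x f \<in> carrier (coord_ring N)"
  unfolding pd_def
proof (rule coord_carrier_sum)
  fix t assume "t \<in> Poly_Mapping.keys f"
  moreover have "Poly_Mapping.keys (t - Poly_Mapping.single x 1) \<subseteq> Poly_Mapping.keys t"
    by (auto simp: in_keys_iff lookup_minus)
  ultimately show "Poly_Mapping.single (t - Poly_Mapping.single x 1)
      (Poly_Mapping.lookup f t * of_nat (Poly_Mapping.lookup t x)) \<in> carrier (coord_ring N)"
    using assms by (auto simp: carrier_coord_ring)
qed

fun gen_bracket :: "nat \<Rightarrow> gen \<Rightarrow> gen \<Rightarrow> coord_poly" where
  "gen_bracket N (Z i) (Z j) =
     (if i < j then - (coord_a i * coord_a j) else if j < i then coord_a i * coord_a j else 0)"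
| "gen_bracket N (Zs i) (Zs j) =
     (if i < j then coord_as i * coord_as j else if j < i then - (coord_as i * coord_as j) else 0)"
| "gen_bracket N (Z i) (Zs j) = (if i = j then 2 * tail_coord N i else - (coord_a i * coord_as j))"
| "gen_bracket N (Zs i) (Z j) = (if i = j then - (2 * tail_coord N i) else coord_as i * coord_a j)"

lemma gen_bracket_carrier [simp]:
  "x \<in> gens N \<Longrightarrow> y \<in> gens N \<Longrightarrow> gen_bracket N x y \<in> carrier (coord_ring N)"
  by (cases x; cases y) auto

lemma gen_bracket_antisym: "gen_bracket N x y = - gen_bracket N y x"
  by (cases x; cases y) (auto simp: mult.commute)

text \<open>The biderivation with the prescribed values on coordinate functions. Antisymmetry and
  the Leibniz rule come with the form; only the Jacobi identity needs the particular values.\<close>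

definition bracket :: "nat \<Rightarrow> coord_poly \<Rightarrow> coord_poly \<Rightarrow> coord_poly" where
  "bracket N f g = (\<Sum>x\<in>gens N. \<Sum>y\<in>gens N. pd x f * pd y g * gen_bracket N x y)"

lemma bracket_antisym: "bracket N f g = - bracket N g f"
proof -
  have "bracket N f g = (\<Sum>y\<in>gens N. \<Sum>x\<in>gens N. pd x f * pd y g * gen_bracket N x y)"
    unfolding bracket_def by (rule sum.swap)
  also have "\<dots> = (\<Sum>y\<in>gens N. \<Sum>x\<in>gens N. - (pd y g * pd x f * gen_bracket N y x))"
    by (intro sum.cong refl, subst gen_bracket_antisym) (simp add: mult.commute)
  finally show ?thesis by (simp add: bracket_def sum_negf)
qed

lemma bracket_add_left: "bracket N (f + g) h = bracket N f h + bracket N g h"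
  by (simp add: bracket_def pd_add distrib_right sum.distrib)

lemma bracket_mult_left: "bracket N (f * g) h = f * bracket N g h + bracket N f h * g"
proof -
  have "bracket N (f * g) h = (\<Sum>x\<in>gens N. \<Sum>y\<in>gens N.
      f * (pd x g * pd y h * gen_bracket N x y) + pd x f * pd y h * gen_bracket N x y * g)"
    unfolding bracket_def by (intro sum.cong refl) (simp add: pd_mult algebra_simps)
  then show ?thesis
    by (simp add: bracket_def sum.distrib sum_distrib_left sum_distrib_right)
qed

lemma bracket_const_left [simp]: "bracket N (coord_const c) h = 0"
  by (simp add: bracket_def)

lemma bracket_add_right: "bracket N h (f + g) = bracket N h f + bracket N h g"
  using bracket_antisym[of N h] by (simp add: bracket_add_left)

lemma bracket_mult_right: "bracket N h (f * g) = f * bracket N h g + bracket N h f * g"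
  using bracket_antisym[of N h] by (simp add: bracket_mult_left)

lemma bracket_const_right [simp]: "bracket N h (coord_const c) = 0"
  using bracket_antisym[of N h] by simp

lemma bracket_zero_right [simp]: "bracket N h 0 = 0"
  using bracket_const_right[of N h 0] by (simp add: coord_const_hom)

lemma bracket_numeral_right [simp]: "bracket N h (numeral n) = 0"
  using bracket_const_right[of N h "numeral n"] by (simp add: coord_const_hom)

lemma bracket_uminus_right: "bracket N h (- f) = - bracket N h f"
  using bracket_add_right[of N h f "- f"] by (simp add: eq_neg_iff_add_eq_0 add.commute)

lemma bracket_sum_right: "bracket N h (sum f K) = (\<Sum>k\<in>K. bracket N h (f k))"
  by (induction K rule: infinite_finite_induct) (simp_all add: bracket_add_right)

lemma bracket_coord:
  assumes "x \<in> gens N" "y \<in> gens N"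
  shows "bracket N (coord x) (coord y) = gen_bracket N x y"
proof -
  have "pd u (coord x) * pd v (coord y) * gen_bracket N u v
      = (if v = y then if u = x then gen_bracket N x y else 0 else 0)" for u v
    by (simp add: pd_coord)
  then show ?thesis
    using assms by (simp add: bracket_def)
qed

lemma bracket_carrier:
  "f \<in> carrier (coord_ring N) \<Longrightarrow> g \<in> carrier (coord_ring N) \<Longrightarrow> bracket N f g \<in> carrier (coord_ring N)"
  unfolding bracket_def by (intro coord_carrier_sum coord_carrier_mult) simp_all

section \<open>The Jacobi identity\<close>

lemma derivation_eq_0:
  assumes "f \<in> carrier (coord_ring N)"
    and "\<And>f g. D (f + g) = D f + D g" "\<And>f g. D (f * g) = f * D g + D f * g"
    and "\<And>c. D (coord_const c) = 0" "\<And>x. x \<in> gens N \<Longrightarrow> D (coord x) = (0 :: coord_poly)"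
  shows "D f = 0"
  using assms(1) by (induction f rule: coord_ring_induct) (simp_all add: assms(2-))

definition jacobiator :: "nat \<Rightarrow> coord_poly \<Rightarrow> coord_poly \<Rightarrow> coord_poly \<Rightarrow> coord_poly" where
  "jacobiator N f g h =
     bracket N f (bracket N g h) + bracket N g (bracket N h f) + bracket N h (bracket N f g)"

lemma jacobiator_rotate: "jacobiator N f g h = jacobiator N g h f"
  by (simp add: jacobiator_def)

text \<open>The jacobiator of an antisymmetric biderivation is a derivation in each argument: the
  mixed products of first brackets cancel by antisymmetry. This reduces Jacobi to coordinate
  functions.\<close>

lemma jacobiator_mult: "jacobiator N (f * f') g h = f * jacobiator N f' g h + jacobiator N f g h * f'"
proof -
  have "jacobiator N (f * f') g h - (f * jacobiator N f' g h + jacobiator N f g h * f')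
      = bracket N h f' * (bracket N g f + bracket N f g) + bracket N h f * (bracket N g f' + bracket N f' g)"
    by (simp add: jacobiator_def bracket_mult_left bracket_mult_right bracket_add_right algebra_simps)
  also have "\<dots> = 0"
    using bracket_antisym[of N f g] bracket_antisym[of N f' g] by simp
  finally show ?thesis by simp
qed

lemma jacobiator_eq_0_left:
  assumes "f \<in> carrier (coord_ring N)" "\<And>x. x \<in> gens N \<Longrightarrow> jacobiator N (coord x) g h = 0"
  shows "jacobiator N f g h = 0"
  by (rule derivation_eq_0[OF assms(1), of "\<lambda>f. jacobiator N f g h"])
     (use assms(2) in \<open>simp_all add: jacobiator_mult\<close>,
      simp_all add: jacobiator_def bracket_add_left bracket_add_right)

lemma bracket_coord_pair:
  assumes "x \<in> gens N" "k < N"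
  shows "bracket N (coord x) (coord_a k * coord_as k)
    = coord_a k * gen_bracket N x (Zs k) + gen_bracket N x (Z k) * coord_as k"
  using assms by (simp add: bracket_mult_right bracket_coord)

text \<open>Against a_j, the summand at k gives 0 for k < j and -2 a_j times itself for k > j, while
  k = j gives 2 a_j times the tail beyond j. If j > i, the last two kinds cancel; this mirrors z_j
  commuting with C.\<close>

lemma bracket_a_tail:
  assumes "j < N"
  shows "bracket N (coord_a j) (tail_coord N i) = (if j \<le> i then - (2 * coord_a j * tail_coord N i) else 0)"
proof -
  have pair: "bracket N (coord_a j) (coord_a k * coord_as k) =
      (if j < k then - (2 * coord_a j * (coord_a k * coord_as k)) else 0)
      + (if j = k then 2 * coord_a j * tail_coord N j else 0)"
    if "k < N" for k
    using that assms by (subst bracket_coord_pair) (auto simp: algebra_simps)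
  have "bracket N (coord_a j) (tail_coord N i)
      = (\<Sum>k\<in>{i<..<N}. if j < k then - (2 * coord_a j * (coord_a k * coord_as k)) else 0)
      + (\<Sum>k\<in>{i<..<N}. if j = k then 2 * coord_a j * tail_coord N j else 0)"
    unfolding tail_coord_def[of N i] bracket_sum_right sum.distrib[symmetric]
    by (intro sum.cong refl pair) simp
  also have "(\<Sum>k\<in>{i<..<N}. if j < k then - (2 * coord_a j * (coord_a k * coord_as k)) else 0)
      = - (2 * coord_a j * tail_coord N (max i j))"
  proof -
    have "{k \<in> {i<..<N}. j < k} = {max i j<..<N}" by auto
    then show ?thesis
      by (simp add: tail_coord_def sum.inter_filter[symmetric] sum_negf sum_distrib_left)
  qed
  finally show ?thesis using assms by (auto simp: max_def)
qed

lemma bracket_as_tail: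
  assumes "j < N"
  shows "bracket N (coord_as j) (tail_coord N i) = (if j \<le> i then 2 * coord_as j * tail_coord N i else 0)"
proof -
  have pair: "bracket N (coord_as j) (coord_a k * coord_as k) =
      (if j < k then 2 * coord_as j * (coord_a k * coord_as k) else 0)
      + (if j = k then - (2 * coord_as j * tail_coord N j) else 0)"
    if "k < N" for k
    using that assms by (subst bracket_coord_pair) (auto simp: algebra_simps)
  have "bracket N (coord_as j) (tail_coord N i)
      = (\<Sum>k\<in>{i<..<N}. if j < k then 2 * coord_as j * (coord_a k * coord_as k) else 0)
      + (\<Sum>k\<in>{i<..<N}. if j = k then - (2 * coord_as j * tail_coord N j) else 0)"
    unfolding tail_coord_def[of N i] bracket_sum_right sum.distrib[symmetric]
    by (intro sum.cong refl pair) simp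
  also have "(\<Sum>k\<in>{i<..<N}. if j < k then 2 * coord_as j * (coord_a k * coord_as k) else 0)
      = 2 * coord_as j * tail_coord N (max i j)"
  proof -
    have "{k \<in> {i<..<N}. j < k} = {max i j<..<N}" by auto
    then show ?thesis
      by (simp add: tail_coord_def sum.inter_filter[symmetric] sum_distrib_left)
  qed
  finally show ?thesis using assms by (auto simp: max_def)
qed

text \<open>By cyclic symmetry only the number of starred coordinates matters, which leaves four
  patterns. The tail sums that appear in inner brackets are handled by \<open>bracket_a_tail\<close>
  and \<open>bracket_as_tail\<close>.\<close>

lemma jacobiator_coord:
  assumes "x \<in> gens N" "y \<in> gens N" "z \<in> gens N"
  shows "jacobiator N (coord x) (coord y) (coord z) = 0"
proof -
  note simps = jacobiator_def bracket_coord bracket_uminus_right bracket_mult_right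
    bracket_a_tail bracket_as_tail algebra_simps
  have zzz: "jacobiator N (coord_a i) (coord_a j) (coord_a k) = 0" if "i < N" "j < N" "k < N" for i j k
    using that by (auto simp: simps)
  have sss: "jacobiator N (coord_as i) (coord_as j) (coord_as k) = 0" if "i < N" "j < N" "k < N" for i j k
    using that by (auto simp: simps)
  have zzs: "jacobiator N (coord_a i) (coord_a j) (coord_as k) = 0" if "i < N" "j < N" "k < N" for i j k
    using that by (auto simp: simps)
  have zss: "jacobiator N (coord_a i) (coord_as j) (coord_as k) = 0" if "i < N" "j < N" "k < N" for i j k
    using that by (auto simp: simps)
  show ?thesis
    using assms zzz sss zzs zss jacobiator_rotate
    by (cases x; cases y; cases z) (simp_all, metis+)
qed

text \<open>Coordinates are replaced by arbitrary polynomials one argument at a time, each rotated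
  to the front for \<open>jacobiator_eq_0_left\<close>.\<close>

lemma jacobiator_eq_0:
  assumes f: "f \<in> carrier (coord_ring N)" and g: "g \<in> carrier (coord_ring N)"
    and h: "h \<in> carrier (coord_ring N)"
  shows "jacobiator N f g h = 0"
proof -
  have 1: "jacobiator N f (coord y) (coord z) = 0" if "y \<in> gens N" "z \<in> gens N" for y z
    using that jacobiator_coord by (intro jacobiator_eq_0_left[OF f])
  have 2: "jacobiator N f g (coord z) = 0" if "z \<in> gens N" for z
  proof -
    have "jacobiator N g (coord z) f = 0"
      using 1 that by (intro jacobiator_eq_0_left[OF g]) (simp flip: jacobiator_rotate[of N f])
    then show ?thesis by (simp add: jacobiator_rotate[of N f])
  qed
  have "jacobiator N h f g = 0"
    using 2 by (intro jacobiator_eq_0_left[OF h]) (simp add: jacobiator_rotate[of N "coord x" for x])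
  then show ?thesis by (simp add: jacobiator_rotate[of N h])
qed

lemma poisson_structure_bracket: "poisson_structure N (bracket N)"
  unfolding poisson_structure_def Let_def
proof (intro conjI ballI allI)
  show "bracket N f g = - bracket N g f" for f g by (rule bracket_antisym)
  show "bracket N f (bracket N g h) + bracket N g (bracket N h f) + bracket N h (bracket N f g) = 0"
    if "f \<in> carrier (coord_ring N)" "g \<in> carrier (coord_ring N)" "h \<in> carrier (coord_ring N)"
    for f g h
    using jacobiator_eq_0[OF that] by (simp add: jacobiator_def)
qed (simp_all add: bracket_carrier bracket_add_left bracket_mult_left)

section \<open>The induced structure and the final statement\<close>

lemma induced_poisson_structure_bracket:
  assumes prim: "primitive_root_of_unity m \<epsilon>" and "odd m \<or> N \<le> 1"
  shows "induced_poisson_structure N m \<epsilon> (bracket N)"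
  unfolding induced_poisson_structure_def
proof (intro conjI ballI poisson_structure_bracket)
  fix x y assume xy: "x \<in> gens N" "y \<in> gens N"
  have m: "m > 0" "\<epsilon> ^ m = 1" "\<epsilon> \<noteq> 0" using primitive_rootD[OF prim] by auto
  have swap: "induced_bracket N m \<epsilon> x y (gen_bracket N x y)"
    if "induced_bracket N m \<epsilon> y x (gen_bracket N y x)"
    using induced_bracket_swap[OF xy(2,1) that] gen_bracket_antisym[of N x y] by simp
  have "induced_bracket N m \<epsilon> x y (gen_bracket N x y)"
  proof (cases x)
    case x: (Z i)
    show ?thesis
    proof (cases y)
      case y: (Z j)
      show ?thesis
        using xy x y swap induced_bracket_z_z[OF m] induced_bracket_self[OF m(2,3), of x N]
        by (cases i j rule: linorder_cases) auto
    next
      case y: (Zs j)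
      show ?thesis
        using xy x y induced_bracket_z_zs[OF m] induced_bracket_z_zs_same[OF assms]
        by (cases "i = j") auto
    qed
  next
    case x: (Zs i)
    show ?thesis
    proof (cases y)
      case y: (Zs j)
      show ?thesis
        using xy x y swap induced_bracket_zs_zs[OF m] induced_bracket_self[OF m(2,3), of x N]
        by (cases i j rule: linorder_cases) auto
    next
      case y: (Z j)
      show ?thesis
        using xy x y swap induced_bracket_z_zs[OF m] induced_bracket_z_zs_same[OF assms]
        by (cases "i = j") auto
    qed
  qed
  then show "induced_bracket N m \<epsilon> x y (bracket N (coord x) (coord y))"
    using xy by (simp add: bracket_coord)
qed

theorem proposition3p5:
  fixes N m :: nat and \<epsilon> :: complex
  assumes "m > 0" and "primitive_root_of_unity m \<epsilon>"
  shows "(\<forall>br. induced_poisson_structure N m \<epsilon> br \<longrightarrow>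
             (\<forall>i j. i < j \<and> j < N \<longrightarrow> br (coord_a i) (coord_a j) = - (coord_a i * coord_a j))
           \<and> (\<forall>i j. i < j \<and> j < N \<longrightarrow> br (coord_as i) (coord_as j) = coord_as i * coord_as j)
           \<and> (\<forall>i j. i < N \<and> j < N \<and> i \<noteq> j \<longrightarrow> br (coord_a i) (coord_as j) = - (coord_a i * coord_as j))
           \<and> (\<forall>i. i < N \<longrightarrow> br (coord_a i) (coord_as i) = 2 * (\<Sum>k\<in>{i<..<N}. coord_a k * coord_as k)))
       \<and> (odd m \<or> N \<le> 1 \<longrightarrow> (\<exists>br. induced_poisson_structure N m \<epsilon> br))
       \<and> (\<forall>i j. i < j \<and> j < N \<longrightarrow> induced_bracket N m \<epsilon> (Z i) (Z j) (- (coord_a i * coord_a j)))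
       \<and> (\<forall>i j. i < j \<and> j < N \<longrightarrow> induced_bracket N m \<epsilon> (Zs i) (Zs j) (coord_as i * coord_as j))
       \<and> (\<forall>i j. i < N \<and> j < N \<and> i \<noteq> j \<longrightarrow> induced_bracket N m \<epsilon> (Z i) (Zs j) (- (coord_a i * coord_as j)))"
proof -
  note m = primitive_rootD[OF assms(2)]
  have unique: "br (coord x) (coord y) = P"
    if "induced_poisson_structure N m \<epsilon> br" "x \<in> gens N" "y \<in> gens N" "induced_bracket N m \<epsilon> x y P"
    for br x y P
    using that induced_bracket_unique[OF m] unfolding induced_poisson_structure_def by blast
  have same: "br (coord_a i) (coord_as i) = 2 * (\<Sum>k\<in>{i<..<N}. coord_a k * coord_as k)"
    if br: "induced_poisson_structure N m \<epsilon> br" and i: "i < N" for br i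
  proof -
    \<comment> \<open>Existence of \<open>br\<close> already forces this: otherwise its value at i =
      N - 2 would contradict \<open>no_induced_bracket_even\<close>.\<close>
    have "odd m \<or> N \<le> 1"
    proof (rule ccontr)
      assume "\<not> (odd m \<or> N \<le> 1)"
      then have "even m" "N \<ge> 2" by auto
      moreover have "Z (N - 2) \<in> gens N" "Zs (N - 2) \<in> gens N" using \<open>N \<ge> 2\<close> by auto
      ultimately show False
        using no_induced_bracket_even[OF assms(2)] br unfolding induced_poisson_structure_def by blast
    qed
    from induced_bracket_z_zs_same[OF assms(2) this i] show ?thesis
      unfolding tail_coord_def using i by (intro unique[OF br]) auto
  qed
  show ?thesis
    using same induced_poisson_structure_bracket[OF assms(2), of N]
      induced_bracket_z_z[OF m] induced_bracket_zs_zs[OF m] induced_bracket_z_zs[OF m]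
    by (intro conjI allI impI) (auto intro!: unique)
qed

end
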